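(* Let $I_1, I_2$ be countable index sets and let $\mathcal{A}_1$ and $\mathcal{A}_2$ be two solid spectral matrix algebras of matrices indexed by $I_1^2$ and $I_2^2$, respectively, such that the associated spaces of rank-four tensors $\widetilde{\mathcal{A}}_1$ and $\widetilde{\mathcal{A}}_2$ (as defined in the context) are inverse-closed in $\mathcal{B}(\ell^2(I_1\times I_2))$. Then $\mathcal{A} = \widetilde{\mathcal{A}}_1 \cap \widetilde{\mathcal{A}}_2$, equipped with the norm $\|A\|_{\mathcal{A}} = \max\{\|A\|_{\widetilde{\mathcal{A}}_1}, \|A\|_{\widetilde{\mathcal{A}}_2}\}$, the doubly contracted tensor product $:$ as multiplication and the adjoint $A\mapsto A^*$ as involution, is an involutive inverse-closed Banach algebra.
   Context: A Banach algebra of matrices indexed by $I^2$ is a linear space of complex matrices $(M_{i,j})_{(i,j)\in I^2}$ with a complete submultiplicative norm that is closed under matrix multiplication. It is involutive if it is closed under the conjugate transpose and the conjugate transpose is isometric; more generally, an involutive Banach algebra is a Banach algebra with a conjugate-linear, product-reversing, isometric involution. A spectral matrix algebra is an involutive Banach algebra $\mathcal{M}$ of matrices indexed by $I^2$ such that (i) every $M\in\mathcal{M}$ defines a bounded operator on $\ell^2(I)$, and (ii) $\mathcal{M}$ is inverse-closed: if $M\in\mathcal{M}$ is invertible in $\mathcal{B}(\ell^2(I))$, then $M^{-1}\in\mathcal{M}$. It is solid if moreover $M\in\mathcal{M}$ and $|N_{i,j}|\le|M_{i,j}|$ for all $(i,j)\in I^2$ imply $N\in\mathcal{M}$ and $\|N\|_{\mathcal{M}}\le\|M\|_{\mathcal{M}}$.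 Let $\mathcal{T}$ be the vector space of all rank-four tensors $A=(A_{i,k,l,j})_{(i,k,l,j)\in I_1\times I_2^2\times I_1}$ with complex entries. For $A\in\mathcal{T}$ and $(i,j)\in I_1^2$ let $A|_{\{i\}\times I_2^2\times\{j\}}$ be the matrix $(A_{i,k,l,j})_{(k,l)\in I_2^2}$, and for $(k,l)\in I_2^2$ let $A|_{I_1\times\{(k,l)\}\times I_1}$ be the matrix $(A_{i,k,l,j})_{(i,j)\in I_1^2}$. Define $$\|A\|_{\widetilde{\mathcal{A}}_1} := \Big\| \big( \| A|_{\{i\}\times I_2^2\times\{j\}} \|_{\mathcal{B}(\ell^2(I_2))} \big)_{(i,j)\in I_1^2} \Big\|_{\mathcal{A}_1},\qquad \|A\|_{\widetilde{\mathcal{A}}_2} := \Big\| \big( \| A|_{I_1\times\{(k,l)\}\times I_1} \|_{\mathcal{B}(\ell^2(I_1))} \big)_{(k,l)\in I_2^2} \Big\|_{\mathcal{A}_2},$$ where $\|\cdot\|_{\mathcal{B}(\ell^2)}$ is the operator norm, and the expressions are taken to be $+\infty$ if some restricted matrix does not define a bounded operator or if the resulting matrix of norms does not lie in $\mathcal{A}_1$ (resp. $\mathcal{A}_2$). Set $\widetilde{\mathcal{A}}_n := \{A\in\mathcal{T} : \|A\|_{\widetilde{\mathcal{A}}_n}<\infty\}$ for $n=1,2$. Multiplication and involution of tensors: $(A:B)_{i,k,l,j} := \sum_{n\in I_2}\sum_{m\in I_1} A_{i,k,n,m}B_{m,n,l,j}$ and $(A^* )_{i,k,l,j} := \overline{A_{j,l,k,i}}$.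 A tensor $A$ acts on sequences $c$ on $I_1\times I_2$ by $(Ac)_{i,k}=\sum_{m\in I_1}\sum_{n\in I_2}A_{i,k,n,m}c_{m,n}$, so that $:$ corresponds to composition of operators. A set $\mathcal{X}$ of tensors defining bounded operators on $\ell^2(I_1\times I_2)$ is inverse-closed if, whenever $A\in\mathcal{X}$ is invertible in $\mathcal{B}(\ell^2(I_1\times I_2))$, the tensor representing $A^{-1}$ belongs to $\mathcal{X}$. *)

theory Defs
  imports "HOL-Analysis.Analysis" "HOL-Library.Function_Algebras"
begin

section \<open>Involutive Banach algebras\<close>

text \<open>The algebra is a subspace \<open>S\<close> of an ambient complex vector space. The norm, the
  multiplication and the involution are total functions of which only the values on \<open>S\<close> matter.
  No unit is required.\<close>

locale involutive_banach_algebra = vector_space scale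
  for scale :: "complex \<Rightarrow> 'v::ab_group_add \<Rightarrow> 'v" +
  fixes S :: "'v set"
    and nrm :: "'v \<Rightarrow> real"
    and mul :: "'v \<Rightarrow> 'v \<Rightarrow> 'v"
    and star :: "'v \<Rightarrow> 'v"
  assumes subspace_S: "subspace S"
    and nrm_nonneg: "x \<in> S \<Longrightarrow> 0 \<le> nrm x"
    and nrm_eq_0_iff: "x \<in> S \<Longrightarrow> nrm x = 0 \<longleftrightarrow> x = 0"
    and nrm_scale: "x \<in> S \<Longrightarrow> nrm (scale a x) = cmod a * nrm x"
    and nrm_triangle: "\<lbrakk>x \<in> S; y \<in> S\<rbrakk> \<Longrightarrow> nrm (x + y) \<le> nrm x + nrm y"
    and complete:
      "\<lbrakk>\<And>n. X n \<in> S; \<And>e. e > 0 \<Longrightarrow> \<exists>N. \<forall>m\<ge>N. \<forall>n\<ge>N. nrm (X m - X n) < e\<rbrakk>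
        \<Longrightarrow> \<exists>L\<in>S. (\<lambda>n::nat. nrm (X n - L)) \<longlonglongrightarrow> 0"
    and mul_closed: "\<lbrakk>x \<in> S; y \<in> S\<rbrakk> \<Longrightarrow> mul x y \<in> S"
    and mul_assoc: "\<lbrakk>x \<in> S; y \<in> S; z \<in> S\<rbrakk> \<Longrightarrow> mul (mul x y) z = mul x (mul y z)"
    and mul_add_left: "\<lbrakk>x \<in> S; y \<in> S; z \<in> S\<rbrakk> \<Longrightarrow> mul (x + y) z = mul x z + mul y z"
    and mul_add_right: "\<lbrakk>x \<in> S; y \<in> S; z \<in> S\<rbrakk> \<Longrightarrow> mul x (y + z) = mul x y + mul x z"
    and mul_scale_left: "\<lbrakk>x \<in> S; y \<in> S\<rbrakk> \<Longrightarrow> mul (scale a x) y = scale a (mul x y)"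
    and mul_scale_right: "\<lbrakk>x \<in> S; y \<in> S\<rbrakk> \<Longrightarrow> mul x (scale a y) = scale a (mul x y)"
    and nrm_mul: "\<lbrakk>x \<in> S; y \<in> S\<rbrakk> \<Longrightarrow> nrm (mul x y) \<le> nrm x * nrm y"
    and star_closed: "x \<in> S \<Longrightarrow> star x \<in> S"
    and star_add: "\<lbrakk>x \<in> S; y \<in> S\<rbrakk> \<Longrightarrow> star (x + y) = star x + star y"
    and star_scale: "x \<in> S \<Longrightarrow> star (scale a x) = scale (cnj a) (star x)"
    and star_mul: "\<lbrakk>x \<in> S; y \<in> S\<rbrakk> \<Longrightarrow> star (mul x y) = mul (star y) (star x)"
    and star_star: "x \<in> S \<Longrightarrow> star (star x) = x"
    and nrm_star: "x \<in> S \<Longrightarrow> nrm (star x) = nrm x"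


section \<open>Bounded operators on square-summable sequences\<close>

definition ell2 :: "('i \<Rightarrow> complex) set" where
  "ell2 = {c. (\<lambda>i. (cmod (c i))\<^sup>2) summable_on UNIV}"

definition ell2_norm :: "('i \<Rightarrow> complex) \<Rightarrow> real" where
  "ell2_norm c = sqrt (\<Sum>\<^sub>\<infinity>i. (cmod (c i))\<^sup>2)"

text \<open>Operators are total functions on sequences; only their restriction to \<open>ell2\<close> matters.\<close>

definition bounded_op :: "(('i \<Rightarrow> complex) \<Rightarrow> ('i \<Rightarrow> complex)) \<Rightarrow> bool" where
  "bounded_op T \<longleftrightarrow>
     (\<forall>c\<in>ell2. T c \<in> ell2) \<and>
     (\<forall>c\<in>ell2. \<forall>d\<in>ell2. T (c + d) = T c + T d) \<and>
     (\<forall>c\<in>ell2. \<forall>a. T (\<lambda>i. a * c i) = (\<lambda>i. a * T c i)) \<and>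
     (\<exists>K. \<forall>c\<in>ell2. ell2_norm (T c) \<le> K * ell2_norm c)"

definition op_norm :: "(('i \<Rightarrow> complex) \<Rightarrow> ('i \<Rightarrow> complex)) \<Rightarrow> real" where
  "op_norm T = (SUP c\<in>{c \<in> ell2. ell2_norm c \<le> 1}. ell2_norm (T c))"

definition is_op_inverse ::
  "(('i \<Rightarrow> complex) \<Rightarrow> ('i \<Rightarrow> complex)) \<Rightarrow> (('i \<Rightarrow> complex) \<Rightarrow> ('i \<Rightarrow> complex)) \<Rightarrow> bool" where
  "is_op_inverse T R \<longleftrightarrow> bounded_op R \<and> (\<forall>c\<in>ell2. R (T c) = c \<and> T (R c) = c)"

definition matrix_of_op :: "(('i \<Rightarrow> complex) \<Rightarrow> ('i \<Rightarrow> complex)) \<Rightarrow> 'i \<Rightarrow> 'i \<Rightarrow> complex" where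
  "matrix_of_op T = (\<lambda>i j. T (\<lambda>l. if l = j then 1 else 0) i)"


section \<open>Matrix algebras\<close>

type_synonym 'i cmat = "'i \<Rightarrow> 'i \<Rightarrow> complex"

definition mat_scale :: "complex \<Rightarrow> 'i cmat \<Rightarrow> 'i cmat" where
  "mat_scale a M = (\<lambda>i j. a * M i j)"

definition mat_mult :: "'i cmat \<Rightarrow> 'i cmat \<Rightarrow> 'i cmat" where
  "mat_mult M N = (\<lambda>i j. \<Sum>\<^sub>\<infinity>l. M i l * N l j)"

definition mat_adj :: "'i cmat \<Rightarrow> 'i cmat" where
  "mat_adj M = (\<lambda>i j. cnj (M j i))"

definition mat_op :: "'i cmat \<Rightarrow> ('i \<Rightarrow> complex) \<Rightarrow> ('i \<Rightarrow> complex)" where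
  "mat_op M c = (\<lambda>i. \<Sum>\<^sub>\<infinity>j. M i j * c j)"

definition bounded_mat :: "'i cmat \<Rightarrow> bool" where
  "bounded_mat M \<longleftrightarrow>
     (\<forall>c\<in>ell2. \<forall>i. (\<lambda>j. M i j * c j) summable_on UNIV) \<and> bounded_op (mat_op M)"

definition inverse_closed :: "'i cmat set \<Rightarrow> bool" where
  "inverse_closed \<M> \<longleftrightarrow>
     (\<forall>M\<in>\<M>. bounded_mat M) \<and>
     (\<forall>M\<in>\<M>. \<forall>R. is_op_inverse (mat_op M) R \<longrightarrow> matrix_of_op R \<in> \<M>)"

definition spectral_matrix_algebra :: "'i cmat set \<Rightarrow> ('i cmat \<Rightarrow> real) \<Rightarrow> bool" where
  "spectral_matrix_algebra \<M> nrm \<longleftrightarrow>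
     involutive_banach_algebra mat_scale \<M> nrm mat_mult mat_adj \<and> inverse_closed \<M>"

definition solid :: "'i cmat set \<Rightarrow> ('i cmat \<Rightarrow> real) \<Rightarrow> bool" where
  "solid \<M> nrm \<longleftrightarrow>
     (\<forall>M\<in>\<M>. \<forall>N. (\<forall>i j. cmod (N i j) \<le> cmod (M i j)) \<longrightarrow> N \<in> \<M> \<and> nrm N \<le> nrm M)"


section \<open>Rank-four tensors\<close>

text \<open>\<open>A i k l j\<close> is the entry with index \<open>(i,k,l,j) \<in> I\<^sub>1 \<times> I\<^sub>2\<^sup>2 \<times> I\<^sub>1\<close>.\<close>

type_synonym ('i, 'k) tensor = "'i \<Rightarrow> 'k \<Rightarrow> 'k \<Rightarrow> 'i \<Rightarrow> complex"

definition tens_scale :: "complex \<Rightarrow> ('i, 'k) tensor \<Rightarrow> ('i, 'k) tensor" where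
  "tens_scale a A = (\<lambda>i k l j. a * A i k l j)"

definition tens_mult :: "('i, 'k) tensor \<Rightarrow> ('i, 'k) tensor \<Rightarrow> ('i, 'k) tensor" where
  "tens_mult A B = (\<lambda>i k l j. \<Sum>\<^sub>\<infinity>n. \<Sum>\<^sub>\<infinity>m. A i k n m * B m n l j)"

definition tens_adj :: "('i, 'k) tensor \<Rightarrow> ('i, 'k) tensor" where
  "tens_adj A = (\<lambda>i k l j. cnj (A j l k i))"

text \<open>The action \<open>(A c)\<^bsub>i,k\<^esub> = \<Sum>\<^bsub>m,n\<^esub> A\<^bsub>i,k,n,m\<^esub> c\<^bsub>m,n\<^esub>\<close> on sequences indexed by \<open>I\<^sub>1 \<times> I\<^sub>2\<close> is the
  action of the following matrix. Note the exchanged order of the last two tensor indices.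
  The map is a bijection between tensors and matrices indexed by \<open>(I\<^sub>1 \<times> I\<^sub>2)\<^sup>2\<close>.\<close>

definition tens_mat :: "('i, 'k) tensor \<Rightarrow> ('i \<times> 'k) cmat" where
  "tens_mat A = (\<lambda>(i, k) (m, n). A i k n m)"

definition tens_inverse_closed :: "('i, 'k) tensor set \<Rightarrow> bool" where
  "tens_inverse_closed \<X> \<longleftrightarrow> inverse_closed (tens_mat ` \<X>)"

text \<open>For a matrix \<open>B\<close> whose entries are themselves matrices: the norm in \<open>\<M>\<close> of the matrix of
  operator norms of the entries, or infinity where this is undefined.\<close>

definition block_norm ::
  "'i cmat set \<Rightarrow> ('i cmat \<Rightarrow> real) \<Rightarrow> ('i \<Rightarrow> 'i \<Rightarrow> 'k cmat) \<Rightarrow> ereal" where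
  "block_norm \<M> nrm B =
     (let Q = (\<lambda>i j. complex_of_real (op_norm (mat_op (B i j))))
      in if (\<forall>i j. bounded_mat (B i j)) \<and> Q \<in> \<M> then ereal (nrm Q) else \<infinity>)"

definition tilde_norm1 ::
  "'i cmat set \<Rightarrow> ('i cmat \<Rightarrow> real) \<Rightarrow> ('i, 'k) tensor \<Rightarrow> ereal" where
  "tilde_norm1 \<A>\<^sub>1 nrm\<^sub>1 A = block_norm \<A>\<^sub>1 nrm\<^sub>1 (\<lambda>i j. \<lambda>k l. A i k l j)"

definition tilde_norm2 ::
  "'k cmat set \<Rightarrow> ('k cmat \<Rightarrow> real) \<Rightarrow> ('i, 'k) tensor \<Rightarrow> ereal" where
  "tilde_norm2 \<A>\<^sub>2 nrm\<^sub>2 A = block_norm \<A>\<^sub>2 nrm\<^sub>2 (\<lambda>k l. \<lambda>i j. A i k l j)"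

definition tilde1 :: "'i cmat set \<Rightarrow> ('i cmat \<Rightarrow> real) \<Rightarrow> ('i, 'k) tensor set" where
  "tilde1 \<A>\<^sub>1 nrm\<^sub>1 = {A. tilde_norm1 \<A>\<^sub>1 nrm\<^sub>1 A < \<infinity>}"

definition tilde2 :: "'k cmat set \<Rightarrow> ('k cmat \<Rightarrow> real) \<Rightarrow> ('i, 'k) tensor set" where
  "tilde2 \<A>\<^sub>2 nrm\<^sub>2 = {A. tilde_norm2 \<A>\<^sub>2 nrm\<^sub>2 A < \<infinity>}"

end

theory Submission
  imports Defs
begin

text \<open>A matrix defines a bounded operator of norm at most \<open>K\<close> iff all its finite bilinear forms are
  bounded by \<open>K\<close>; this criterion is symmetric and stable under entrywise limits. Solidity reduces
  every estimate in the tensor algebras to an entrywise one: the matrix of block norms of \<open>A : B\<close> is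
  dominated by the product of the matrices of block norms. It also makes each entry a continuous
  functional on \<open>\<A>\<^sub>n\<close>, because the matrix unit at that entry, if it occurs, has positive
  norm. So Cauchy sequences of tensors converge entrywise, and this gives completeness of each
  tensor algebra and shows that the two limits taken for the intersection coincide. The second
  algebra is the first one with the roles of the index sets exchanged. Associativity holds because
  all tensors involved act boundedly on \<open>\<ell>\<^sup>2\<close>.\<close>

section \<open>Square-summable sequences and bounded matrices\<close>

text \<open>Finite block norms control single blocks, but the product \<open>:\<close> is a double
  series over pairs, and its order of summation matters: \<open>tens_mult\<close> sums over the
  first index set inside, while a block of A : B is a sum over that index set of products of blocks.
  The two are reconciled by boundedness on \<open>ell2\<close> over pairs, which is part of the
  hypothesis \<open>tens_inverse_closed\<close>: rows and columns of the matrices of the tensors are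
  then square-summable, the double series converges absolutely, and either order may be used. The
  same exchange lets the second algebra be read as one of the first kind. Exact operator norms are
  hardly ever available, so estimates run through upper bounds of bilinear forms, and solidity is
  applied to dominating matrices instead of the true block norms.\<close>

lemma has_sum_finite_sum:
  fixes f :: "'a \<Rightarrow> 'b \<Rightarrow> 'c::topological_comm_monoid_add"
  assumes "finite F" "\<And>i. i \<in> F \<Longrightarrow> (f i has_sum s i) A"
  shows "((\<lambda>x. \<Sum>i\<in>F. f i x) has_sum (\<Sum>i\<in>F. s i)) A"
  using assms by (induction F rule: finite_induct) (auto intro!: has_sum_add)

lemma infsum_finite_sum:
  fixes f :: "'a \<Rightarrow> 'b \<Rightarrow> 'c::{topological_comm_monoid_add, t2_space}"
  assumes "finite F" "\<And>i. i \<in> F \<Longrightarrow> f i summable_on A"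
  shows "(\<Sum>\<^sub>\<infinity>x\<in>A. \<Sum>i\<in>F. f i x) = (\<Sum>i\<in>F. \<Sum>\<^sub>\<infinity>x\<in>A. f i x)"
  using assms by (intro infsumI has_sum_finite_sum) auto

lemma summable_on_finite_sum:
  fixes f :: "'a \<Rightarrow> 'b \<Rightarrow> 'c::{topological_comm_monoid_add, t2_space}"
  assumes "finite F" "\<And>i. i \<in> F \<Longrightarrow> f i summable_on A"
  shows "(\<lambda>x. \<Sum>i\<in>F. f i x) summable_on A"
  by (rule has_sum_imp_summable, rule has_sum_finite_sum[OF assms(1)]) (rule has_sum_infsum[OF assms(2)])

section \<open>Norm, Cauchy-Schwarz inequality and truncation in \<open>ell2\<close>\<close>

lemma ell2I_bound:
  assumes "\<And>F. finite F \<Longrightarrow> L2_set (\<lambda>i. cmod (c i)) F \<le> K"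
  shows "c \<in> ell2" and "ell2_norm c \<le> K"
proof -
  have K: "0 \<le> K" using assms[of "{}"] by simp
  have *: "(\<Sum>i\<in>F. (cmod (c i))\<^sup>2) \<le> K\<^sup>2" if "finite F" for F
    using assms[OF that] by (simp add: L2_set_def sqrt_le_D)
  show s: "c \<in> ell2" unfolding ell2_def
    using * by (auto intro!: nonneg_bdd_above_summable_on bdd_aboveI[of _ "K\<^sup>2"])
  have "(\<Sum>\<^sub>\<infinity>i. (cmod (c i))\<^sup>2) \<le> K\<^sup>2"
    using s * by (intro infsum_le_finite_sums) (auto simp: ell2_def)
  then show "ell2_norm c \<le> K" unfolding ell2_norm_def
    using K by (simp add: real_le_lsqrt)
qed

lemma ell2_norm_nonneg [simp]: "0 \<le> ell2_norm c"
  by (simp add: ell2_norm_def infsum_nonneg)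

lemma L2_set_le_ell2_norm:
  assumes "c \<in> ell2" "finite F"
  shows "L2_set (\<lambda>i. cmod (c i)) F \<le> ell2_norm c"
  using assms unfolding L2_set_def ell2_norm_def ell2_def
  by (auto intro!: finite_sum_le_infsum)

lemma cmod_le_ell2_norm:
  assumes "c \<in> ell2" shows "cmod (c i) \<le> ell2_norm c"
  using L2_set_le_ell2_norm[OF assms, of "{i}"] by simp

lemma ell2_add:
  assumes "c \<in> ell2" "d \<in> ell2"
  shows "c + d \<in> ell2" and "ell2_norm (c + d) \<le> ell2_norm c + ell2_norm d"
proof -
  have "L2_set (\<lambda>i. cmod ((c + d) i)) F \<le> ell2_norm c + ell2_norm d" if "finite F" for F
  proof -
    have "L2_set (\<lambda>i. cmod ((c + d) i)) F \<le> L2_set (\<lambda>i. cmod (c i) + cmod (d i)) F"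
      by (rule L2_set_mono) (auto simp: norm_triangle_ineq)
    also have "\<dots> \<le> L2_set (\<lambda>i. cmod (c i)) F + L2_set (\<lambda>i. cmod (d i)) F"
      by (rule L2_set_triangle_ineq)
    also have "\<dots> \<le> ell2_norm c + ell2_norm d"
      using assms that by (intro add_mono L2_set_le_ell2_norm)
    finally show ?thesis .
  qed
  note * = ell2I_bound[OF this]
  show "c + d \<in> ell2" "ell2_norm (c + d) \<le> ell2_norm c + ell2_norm d"
    using * by blast+
qed

lemma ell2_scale:
  assumes "c \<in> ell2"
  shows "(\<lambda>i. a * c i) \<in> ell2" and "ell2_norm (\<lambda>i. a * c i) = cmod a * ell2_norm c"
  using assms
  by (auto simp: ell2_def ell2_norm_def norm_mult power_mult_distrib infsum_cmult_right'
      real_sqrt_mult intro!: summable_on_cmult_right)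

lemma ell2_norm_finite:
  assumes "finite G" "\<And>i. i \<notin> G \<Longrightarrow> c i = 0"
  shows "c \<in> ell2" and "ell2_norm c = L2_set (\<lambda>i. cmod (c i)) G"
proof -
  have "((\<lambda>i. (cmod (c i))\<^sup>2) has_sum (\<Sum>i\<in>G. (cmod (c i))\<^sup>2)) UNIV"
    using assms by (intro has_sum_finite_neutralI[of G]) auto
  then show "c \<in> ell2" "ell2_norm c = L2_set (\<lambda>i. cmod (c i)) G"
    by (auto simp: ell2_def ell2_norm_def L2_set_def infsumI has_sum_imp_summable)
qed

text \<open>Cauchy-Schwarz on finite sections, then the supremum over them. There is no conjugation,
  to match the bilinear forms used below.\<close>

lemma ell2_mult:
  assumes "c \<in> ell2" "d \<in> ell2"
  shows "(\<lambda>i. norm (c i * d i)) summable_on UNIV"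
    and "cmod (\<Sum>\<^sub>\<infinity>i. c i * d i) \<le> ell2_norm c * ell2_norm d"
proof -
  have *: "(\<Sum>i\<in>F. norm (c i * d i)) \<le> ell2_norm c * ell2_norm d" if "finite F" for F
  proof -
    have "(\<Sum>i\<in>F. norm (c i * d i)) \<le> L2_set (\<lambda>i. cmod (c i)) F * L2_set (\<lambda>i. cmod (d i)) F"
      using L2_set_mult_ineq[of "\<lambda>i. cmod (c i)" "\<lambda>i. cmod (d i)" F] by (simp add: norm_mult)
    also have "\<dots> \<le> ell2_norm c * ell2_norm d"
      using assms that by (intro mult_mono L2_set_le_ell2_norm) (auto simp: L2_set_nonneg)
    finally show ?thesis .
  qed
  then show s: "(\<lambda>i. norm (c i * d i)) summable_on UNIV"
    by (auto intro!: nonneg_bdd_above_summable_on bdd_aboveI[of _ "ell2_norm c * ell2_norm d"])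
  have "cmod (\<Sum>\<^sub>\<infinity>i. c i * d i) \<le> (\<Sum>\<^sub>\<infinity>i. norm (c i * d i))"
    by (rule norm_infsum_bound) (use s in simp)
  also have "\<dots> \<le> ell2_norm c * ell2_norm d"
    using s * by (intro infsum_le_finite_sums) auto
  finally show "cmod (\<Sum>\<^sub>\<infinity>i. c i * d i) \<le> ell2_norm c * ell2_norm d" .
qed

lemma ell2_mult_summable:
  assumes "c \<in> ell2" "d \<in> ell2"
  shows "(\<lambda>i. c i * d i) summable_on UNIV"
  using ell2_mult(1)[OF assms] by (rule Infinite_Sum.abs_summable_summable)

text \<open>The squared norm of the tail is exactly the total sum minus the partial sum. This
  supplies the approximation by finite truncations in \<open>mat_op_transpose\<close>.\<close>

lemma ell2_tail_tendsto_0: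
  assumes "c \<in> ell2"
  shows "((\<lambda>G. ell2_norm (\<lambda>i. if i \<in> G then 0 else c i)) \<longlongrightarrow> 0) (finite_subsets_at_top UNIV)"
proof -
  let ?f = "\<lambda>i. (cmod (c i))\<^sup>2"
  have s: "?f summable_on UNIV" using assms by (simp add: ell2_def)
  have "((\<lambda>G. sqrt (infsum ?f UNIV - sum ?f G)) \<longlongrightarrow> sqrt (infsum ?f UNIV - infsum ?f UNIV))
      (finite_subsets_at_top UNIV)"
    using infsum_tendsto[OF s] by (intro tendsto_intros)
  moreover have "\<forall>\<^sub>F G in finite_subsets_at_top UNIV.
      sqrt (infsum ?f UNIV - sum ?f G) = ell2_norm (\<lambda>i. if i \<in> G then 0 else c i)"
  proof (rule eventually_finite_subsets_at_top_weakI)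
    fix G :: "'a set" assume "finite G"
    have "infsum ?f UNIV - sum ?f G = infsum ?f (UNIV - G)"
      using \<open>finite G\<close> s by (subst infsum_Diff) auto
    also have "\<dots> = (\<Sum>\<^sub>\<infinity>i. (cmod (if i \<in> G then 0 else c i))\<^sup>2)"
      by (rule infsum_cong_neutral) auto
    finally show "sqrt (infsum ?f UNIV - sum ?f G) = ell2_norm (\<lambda>i. if i \<in> G then 0 else c i)"
      by (simp add: ell2_norm_def)
  qed
  ultimately show ?thesis by (simp add: tendsto_cong)
qed

section \<open>Matrices with bounded bilinear forms on finite sections\<close>

text \<open>The bilinear form, without conjugation, makes the bound invariant under transposition.\<close>

definition form_bound :: "'i cmat \<Rightarrow> real \<Rightarrow> bool" where
  "form_bound M K \<longleftrightarrow> 0 \<le> K \<and>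
     (\<forall>F G c d. finite F \<longrightarrow> finite G \<longrightarrow>
       cmod (\<Sum>i\<in>F. \<Sum>j\<in>G. d i * M i j * c j)
         \<le> K * L2_set (\<lambda>i. cmod (d i)) F * L2_set (\<lambda>j. cmod (c j)) G)"

lemma form_boundD:
  assumes "form_bound M K"
  shows "0 \<le> K"
    and "\<lbrakk>finite F; finite G\<rbrakk> \<Longrightarrow> cmod (\<Sum>i\<in>F. \<Sum>j\<in>G. d i * M i j * c j)
         \<le> K * L2_set (\<lambda>i. cmod (d i)) F * L2_set (\<lambda>j. cmod (c j)) G"
  using assms by (auto simp: form_bound_def)

lemma form_bound_transpose:
  assumes "form_bound M K" shows "form_bound (\<lambda>i j. M j i) K"
  unfolding form_bound_def
proof (intro conjI allI impI)
  show "0 \<le> K" using assms by (rule form_boundD)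
  fix F G :: "'a set" and c d :: "'a \<Rightarrow> complex" assume "finite F" "finite G"
  have "(\<Sum>i\<in>F. \<Sum>j\<in>G. d i * M j i * c j) = (\<Sum>j\<in>G. \<Sum>i\<in>F. c j * M j i * d i)"
    by (subst sum.swap) (simp add: mult_ac)
  then show "cmod (\<Sum>i\<in>F. \<Sum>j\<in>G. d i * M j i * c j)
      \<le> K * L2_set (\<lambda>i. cmod (d i)) F * L2_set (\<lambda>j. cmod (c j)) G"
    using form_boundD(2)[OF assms \<open>finite G\<close> \<open>finite F\<close>, of c d] by (simp add: mult_ac)
qed

text \<open>The conjugation of the transposed entries is moved to the test vectors, whose norms it
  preserves.\<close>

lemma form_bound_adj:
  assumes "form_bound M K" shows "form_bound (mat_adj M) K"
  unfolding form_bound_def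
proof (intro conjI allI impI)
  show "0 \<le> K" using assms by (rule form_boundD)
  fix F G :: "'a set" and c d :: "'a \<Rightarrow> complex" assume "finite F" "finite G"
  have "(\<Sum>i\<in>F. \<Sum>j\<in>G. d i * mat_adj M i j * c j) = cnj (\<Sum>i\<in>F. \<Sum>j\<in>G. cnj (d i) * M j i * cnj (c j))"
    by (simp add: mat_adj_def)
  then have "cmod (\<Sum>i\<in>F. \<Sum>j\<in>G. d i * mat_adj M i j * c j)
      = cmod (\<Sum>i\<in>F. \<Sum>j\<in>G. cnj (d i) * M j i * cnj (c j))"
    by (simp only: complex_mod_cnj)
  then show "cmod (\<Sum>i\<in>F. \<Sum>j\<in>G. d i * mat_adj M i j * c j)
      \<le> K * L2_set (\<lambda>i. cmod (d i)) F * L2_set (\<lambda>j. cmod (c j)) G"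
    using form_boundD(2)[OF form_bound_transpose[OF assms] \<open>finite F\<close> \<open>finite G\<close>, of "\<lambda>i. cnj (d i)" "\<lambda>i. cnj (c i)"]
    by simp
qed

lemma form_bound_add:
  assumes "form_bound M K" "form_bound N L" shows "form_bound (M + N) (K + L)"
  unfolding form_bound_def
proof (intro conjI allI impI)
  show "0 \<le> K + L" using assms by (auto simp: form_bound_def)
  fix F G :: "'a set" and c d :: "'a \<Rightarrow> complex" assume fin: "finite F" "finite G"
  have "(\<Sum>i\<in>F. \<Sum>j\<in>G. d i * (M + N) i j * c j)
      = (\<Sum>i\<in>F. \<Sum>j\<in>G. d i * M i j * c j) + (\<Sum>i\<in>F. \<Sum>j\<in>G. d i * N i j * c j)"
    by (simp add: algebra_simps sum.distrib)
  then show "cmod (\<Sum>i\<in>F. \<Sum>j\<in>G. d i * (M + N) i j * c j)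
      \<le> (K + L) * L2_set (\<lambda>i. cmod (d i)) F * L2_set (\<lambda>j. cmod (c j)) G"
    using form_boundD(2)[OF assms(1) fin, of d c] form_boundD(2)[OF assms(2) fin, of d c]
      norm_triangle_ineq[of "\<Sum>i\<in>F. \<Sum>j\<in>G. d i * M i j * c j" "\<Sum>i\<in>F. \<Sum>j\<in>G. d i * N i j * c j"]
    by (simp add: algebra_simps)
qed

lemma form_bound_scale:
  assumes "form_bound M K" shows "form_bound (mat_scale a M) (cmod a * K)"
  unfolding form_bound_def
proof (intro conjI allI impI)
  show "0 \<le> cmod a * K" using assms by (auto simp: form_bound_def)
  fix F G :: "'a set" and c d :: "'a \<Rightarrow> complex" assume fin: "finite F" "finite G"
  have "(\<Sum>i\<in>F. \<Sum>j\<in>G. d i * mat_scale a M i j * c j) = a * (\<Sum>i\<in>F. \<Sum>j\<in>G. d i * M i j * c j)"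
    by (simp add: mat_scale_def sum_distrib_left mult_ac)
  then show "cmod (\<Sum>i\<in>F. \<Sum>j\<in>G. d i * mat_scale a M i j * c j)
      \<le> cmod a * K * L2_set (\<lambda>i. cmod (d i)) F * L2_set (\<lambda>j. cmod (c j)) G"
    using mult_left_mono[OF form_boundD(2)[OF assms(1) fin, of d c], of "cmod a"]
    by (simp add: norm_mult mult_ac)
qed

text \<open>Test vectors are pushed forward along \<open>f\<close>, which preserves their norms by
  injectivity. The intended \<open>f\<close> is the exchange of the components of a pair.\<close>

lemma form_bound_reindex:
  assumes "form_bound M K" "inj f" shows "form_bound (\<lambda>x y. M (f x) (f y)) K"
  unfolding form_bound_def
proof (intro conjI allI impI)
  show "0 \<le> K" using assms by (auto simp: form_bound_def)
  fix F G :: "'b set" and c d :: "'b \<Rightarrow> complex" assume fin: "finite F" "finite G"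
  have inj: "inj_on f A" for A using assms(2) by (rule inj_on_subset) simp
  show "cmod (\<Sum>i\<in>F. \<Sum>j\<in>G. d i * M (f i) (f j) * c j)
      \<le> K * L2_set (\<lambda>i. cmod (d i)) F * L2_set (\<lambda>j. cmod (c j)) G"
    using form_boundD(2)[OF assms(1), of "f ` F" "f ` G" "d \<circ> inv f" "c \<circ> inv f"] fin assms(2)
    by (simp add: L2_set_def sum.reindex[OF inj])
qed

text \<open>Each inequality involves finitely many entries, so entrywise convergence is enough. The
  filter is arbitrary because both sequences of tensors and nets of finite partial sums occur, and
  the bound may vary along it.\<close>

lemma form_bound_tendsto:
  fixes M :: "'i cmat"
  assumes "\<And>i j. ((\<lambda>n. X n i j) \<longlongrightarrow> M i j) H" "(k \<longlongrightarrow> K) H" "H \<noteq> bot"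
    and "\<forall>\<^sub>F n in H. form_bound (X n) (k n)"
  shows "form_bound M K"
  unfolding form_bound_def
proof (intro conjI allI impI)
  show "0 \<le> K" by (rule tendsto_lowerbound[OF assms(2) _ assms(3)])
      (use assms(4) in \<open>auto elim!: eventually_mono simp: form_bound_def\<close>)
  fix F G :: "'i set" and c d :: "'i \<Rightarrow> complex" assume fin: "finite F" "finite G"
  show "cmod (\<Sum>i\<in>F. \<Sum>j\<in>G. d i * M i j * c j)
      \<le> K * L2_set (\<lambda>i. cmod (d i)) F * L2_set (\<lambda>j. cmod (c j)) G"
  proof (rule tendsto_le[OF assms(3)])
    show "((\<lambda>n. cmod (\<Sum>i\<in>F. \<Sum>j\<in>G. d i * X n i j * c j)) \<longlongrightarrow>
        cmod (\<Sum>i\<in>F. \<Sum>j\<in>G. d i * M i j * c j)) H"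
      by (intro tendsto_intros assms)
    show "((\<lambda>n. k n * L2_set (\<lambda>i. cmod (d i)) F * L2_set (\<lambda>j. cmod (c j)) G) \<longlongrightarrow>
        K * L2_set (\<lambda>i. cmod (d i)) F * L2_set (\<lambda>j. cmod (c j)) G) H"
      by (intro tendsto_intros assms)
    show "\<forall>\<^sub>F n in H. cmod (\<Sum>i\<in>F. \<Sum>j\<in>G. d i * X n i j * c j)
        \<le> k n * L2_set (\<lambda>i. cmod (d i)) F * L2_set (\<lambda>j. cmod (c j)) G"
      using assms(4) by eventually_elim (use fin in \<open>auto intro: form_boundD\<close>)
  qed
qed

section \<open>From bounded forms to bounded operators and back\<close>

lemma form_bound_L2_set:
  assumes "form_bound M K" "finite F" "finite G"
  shows "L2_set (\<lambda>i. cmod (\<Sum>j\<in>G. M i j * c j)) F \<le> K * L2_set (\<lambda>j. cmod (c j)) G"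
proof -
  let ?v = "\<lambda>i. \<Sum>j\<in>G. M i j * c j"
  let ?L = "L2_set (\<lambda>i. cmod (?v i)) F"
  \<comment> \<open>The form is tested against the conjugate of the image vector itself, so its
    value is the squared norm \<open>?L * ?L\<close>. Cancelling one factor \<open>?L\<close> gives
    the claim; for \<open>?L = 0\<close> it is trivial.\<close>
  have "(\<Sum>i\<in>F. \<Sum>j\<in>G. cnj (?v i) * M i j * c j) = (\<Sum>i\<in>F. cnj (?v i) * ?v i)"
    by (simp add: sum_distrib_left mult.assoc)
  also have "\<dots> = (\<Sum>i\<in>F. complex_of_real ((cmod (?v i))\<^sup>2))"
    by (intro sum.cong refl) (metis complex_norm_square mult.commute of_real_power)
  also have "\<dots> = complex_of_real (?L\<^sup>2)"
    by (simp add: L2_set_def sum_nonneg)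
  finally have "?L\<^sup>2 \<le> K * ?L * L2_set (\<lambda>j. cmod (c j)) G"
    using form_boundD(2)[OF assms, of "\<lambda>i. cnj (?v i)" c]
    by (simp add: norm_power del: complex_cnj_mult cnj_sum)
  then have "?L * ?L \<le> ?L * (K * L2_set (\<lambda>j. cmod (c j)) G)"
    by (simp add: power2_eq_square mult_ac)
  moreover have "0 \<le> K * L2_set (\<lambda>j. cmod (c j)) G"
    using assms by (auto simp: form_bound_def L2_set_nonneg)
  ultimately show ?thesis
    using L2_set_nonneg[of "\<lambda>i. cmod (?v i)" F] by (cases "?L = 0") auto
qed

lemma form_bound_column:
  assumes "form_bound M K"
  shows "(\<lambda>i. M i j) \<in> ell2" and "ell2_norm (\<lambda>i. M i j) \<le> K"
proof -
  have "L2_set (\<lambda>i. cmod (M i j)) F \<le> K" if "finite F" for F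
    using form_bound_L2_set[OF assms that, of "{j}" "\<lambda>_. 1"] by simp
  note * = ell2I_bound[OF this]
  show "(\<lambda>i. M i j) \<in> ell2" "ell2_norm (\<lambda>i. M i j) \<le> K"
    using * by blast+
qed

lemma form_bound_row:
  assumes "form_bound M K"
  shows "M i \<in> ell2" and "ell2_norm (M i) \<le> K"
  using form_bound_column[OF form_bound_transpose[OF assms], of i] by auto

lemma form_bound_entry:
  assumes "form_bound M K" shows "cmod (M i j) \<le> K"
  by (rule order_trans[OF cmod_le_ell2_norm[OF form_bound_row(1)[OF assms]] form_bound_row(2)[OF assms]])

text \<open>Square-summable rows make the series of \<open>mat_op M c\<close> converge. With
  \<open>F\<close> fixed, the estimate for finite sections passes to the limit in \<open>G\<close>;
  the resulting bound is uniform in \<open>F\<close>.\<close>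

lemma form_bound_mat_op:
  assumes "form_bound M K" "c \<in> ell2"
  shows "mat_op M c \<in> ell2" and "ell2_norm (mat_op M c) \<le> K * ell2_norm c"
proof -
  have "L2_set (\<lambda>i. cmod (mat_op M c i)) F \<le> K * ell2_norm c" if "finite F" for F
  proof (rule tendsto_upperbound)
    show "((\<lambda>G. L2_set (\<lambda>i. cmod (\<Sum>j\<in>G. M i j * c j)) F) \<longlongrightarrow> L2_set (\<lambda>i. cmod (mat_op M c i)) F)
        (finite_subsets_at_top UNIV)"
      unfolding L2_set_def mat_op_def
      by (intro tendsto_intros infsum_tendsto ell2_mult_summable form_bound_row[OF assms(1)] assms)
    show "\<forall>\<^sub>F G in finite_subsets_at_top UNIV.
        L2_set (\<lambda>i. cmod (\<Sum>j\<in>G. M i j * c j)) F \<le> K * ell2_norm c"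
    proof (rule eventually_finite_subsets_at_top_weakI)
      fix G :: "'a set" assume "finite G"
      then have "L2_set (\<lambda>i. cmod (\<Sum>j\<in>G. M i j * c j)) F \<le> K * L2_set (\<lambda>j. cmod (c j)) G"
        using form_bound_L2_set assms that by blast
      also have "\<dots> \<le> K * ell2_norm c"
        using \<open>finite G\<close> assms by (intro mult_left_mono L2_set_le_ell2_norm) (auto simp: form_bound_def)
      finally show "L2_set (\<lambda>i. cmod (\<Sum>j\<in>G. M i j * c j)) F \<le> K * ell2_norm c" .
    qed
  qed simp
  note * = ell2I_bound[OF this]
  show "mat_op M c \<in> ell2" "ell2_norm (mat_op M c) \<le> K * ell2_norm c"
    using * by blast+
qed

lemma mat_op_add:
  assumes "form_bound M K" "c \<in> ell2" "d \<in> ell2"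
  shows "mat_op M (c + d) = mat_op M c + mat_op M d"
  unfolding mat_op_def
  using assms by (auto simp: fun_eq_iff algebra_simps
      intro!: infsum_add ell2_mult_summable form_bound_row[OF assms(1)])

lemma mat_op_scale: "mat_op M (\<lambda>i. a * c i) = (\<lambda>i. a * mat_op M c i)"
  unfolding mat_op_def
  by (subst infsum_cmult_right'[symmetric]) (simp add: mult_ac)

text \<open>Together with \<open>bounded_mat_form_bound\<close> this identifies
  \<open>op_norm\<close> with the least form bound of a bounded matrix. Operator norms are estimated
  below by proving a bound for forms and translating it through this pair.\<close>

lemma form_bound_imp_bounded_mat:
  assumes "form_bound M K"
  shows "bounded_mat M" and "op_norm (mat_op M) \<le> K"
proof -
  show "bounded_mat M"
    unfolding bounded_mat_def bounded_op_def
    using assms form_bound_mat_op[OF assms] mat_op_add[OF assms] mat_op_scale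
    by (auto intro!: ell2_mult_summable form_bound_row[OF assms])
  have "ell2_norm (mat_op M c) \<le> K" if "c \<in> ell2" "ell2_norm c \<le> 1" for c
    using form_bound_mat_op(2)[OF assms that(1)] mult_left_mono[OF that(2) form_boundD(1)[OF assms]]
    by simp
  \<comment> \<open>A least-upper-bound argument for real suprema requires the unit ball to be
    nonempty.\<close>
  moreover have "(\<lambda>_. 0) \<in> {c \<in> ell2. ell2_norm c \<le> 1}"
    by (auto simp: ell2_def ell2_norm_def)
  ultimately show "op_norm (mat_op M) \<le> K"
    unfolding op_norm_def by (intro cSUP_least) auto
qed

lemma bounded_op_norm_le:
  assumes "bounded_op T" "c \<in> ell2"
  shows "ell2_norm (T c) \<le> op_norm T * ell2_norm c" and "0 \<le> op_norm T"
proof -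
  obtain K where K: "\<And>c. c \<in> ell2 \<Longrightarrow> ell2_norm (T c) \<le> K * ell2_norm c"
    using assms(1) unfolding bounded_op_def by blast
  \<comment> \<open>The constant \<open>K\<close> comes without a sign; its absolute value bounds
    the values on the unit ball, which makes the supremum in \<open>op_norm\<close>
    meaningful.\<close>
  have "ell2_norm (T c) \<le> \<bar>K\<bar>" if "c \<in> ell2" "ell2_norm c \<le> 1" for c
    using K[OF that(1)] that(2) mult_mono[of K "\<bar>K\<bar>" "ell2_norm c" 1] abs_ge_self[of K] ell2_norm_nonneg[of c]
    by linarith
  then have bdd: "bdd_above ((\<lambda>c. ell2_norm (T c)) ` {c \<in> ell2. ell2_norm c \<le> 1})"
    by (auto simp: bdd_above_def)
  have le: "ell2_norm (T c) \<le> op_norm T" if "c \<in> ell2" "ell2_norm c \<le> 1" for c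
    unfolding op_norm_def using that by (intro cSUP_upper bdd) auto
  have "(\<lambda>_. 0) \<in> ell2" "ell2_norm (\<lambda>_. 0) \<le> 1" by (auto simp: ell2_def ell2_norm_def)
  from le[OF this] show "0 \<le> op_norm T" using ell2_norm_nonneg order_trans by blast
  show "ell2_norm (T c) \<le> op_norm T * ell2_norm c"
  proof (cases "ell2_norm c = 0")
    case True
    then show ?thesis using K[OF assms(2)] by simp
  next
    case False
    let ?a = "complex_of_real (1 / ell2_norm c)"
    have a: "cmod ?a = 1 / ell2_norm c" by (simp add: norm_divide)
    have "ell2_norm (T (\<lambda>i. ?a * c i)) \<le> op_norm T"
      using ell2_scale[OF assms(2), of ?a] False by (intro le) (auto simp: norm_divide)
    moreover have "T (\<lambda>i. ?a * c i) = (\<lambda>i. ?a * T c i)" and "T c \<in> ell2"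
      using assms unfolding bounded_op_def by blast+
    ultimately have "ell2_norm (T c) / ell2_norm c \<le> op_norm T"
      using ell2_scale(2)[of "T c" ?a] a by simp
    moreover have "0 < ell2_norm c" using False ell2_norm_nonneg[of c] by linarith
    ultimately show ?thesis by (simp add: divide_le_eq)
  qed
qed

lemma bounded_mat_form_bound:
  assumes "bounded_mat M"
  shows "form_bound M (op_norm (mat_op M))"
  unfolding form_bound_def
proof (intro conjI allI impI)
  have b: "bounded_op (mat_op M)" using assms by (simp add: bounded_mat_def)
  have "(\<lambda>_. 0) \<in> ell2" by (simp add: ell2_def)
  then show "0 \<le> op_norm (mat_op M)" using bounded_op_norm_le(2)[OF b] by blast
  fix F G :: "'a set" and c d :: "'a \<Rightarrow> complex" assume fin: "finite F" "finite G"
  define e where "e = (\<lambda>j. if j \<in> G then c j else 0)"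
  have e: "e \<in> ell2" "ell2_norm e = L2_set (\<lambda>j. cmod (c j)) G"
    using ell2_norm_finite[OF fin(2), of e] by (auto simp: e_def L2_set_def)
  have Me: "mat_op M e i = (\<Sum>j\<in>G. M i j * c j)" for i
    unfolding mat_op_def e_def
    by (intro infsumI has_sum_finite_neutralI[OF fin(2)]) auto
  have "cmod (\<Sum>i\<in>F. \<Sum>j\<in>G. d i * M i j * c j) = cmod (\<Sum>i\<in>F. d i * mat_op M e i)"
    by (simp add: Me sum_distrib_left mult.assoc)
  also have "\<dots> \<le> (\<Sum>i\<in>F. cmod (d i) * cmod (mat_op M e i))"
    by (metis (mono_tags, lifting) norm_mult sum_norm_le order_refl)
  also have "\<dots> \<le> L2_set (\<lambda>i. cmod (d i)) F * L2_set (\<lambda>i. cmod (mat_op M e i)) F"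
    using L2_set_mult_ineq[of "\<lambda>i. cmod (d i)" "\<lambda>i. cmod (mat_op M e i)" F] by simp
  also have "\<dots> \<le> L2_set (\<lambda>i. cmod (d i)) F * ell2_norm (mat_op M e)"
    using b e fin by (intro mult_left_mono L2_set_le_ell2_norm) (auto simp: bounded_op_def L2_set_nonneg)
  also have "\<dots> \<le> L2_set (\<lambda>i. cmod (d i)) F * (op_norm (mat_op M) * ell2_norm e)"
    by (intro mult_left_mono bounded_op_norm_le(1)[OF b e(1)]) (auto simp: L2_set_nonneg)
  finally show "cmod (\<Sum>i\<in>F. \<Sum>j\<in>G. d i * M i j * c j)
      \<le> op_norm (mat_op M) * L2_set (\<lambda>i. cmod (d i)) F * L2_set (\<lambda>j. cmod (c j)) G"
    by (simp add: e(2) mult_ac)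
qed

section \<open>Transposition, associativity and norms of matrix products\<close>

text \<open>The double sum need not converge absolutely, so Fubini does not apply; instead \<open>c\<close> is
  approximated by its finite truncations.\<close>

lemma mat_op_transpose:
  assumes N: "form_bound N K" and x: "x \<in> ell2" and c: "c \<in> ell2"
  shows "(\<Sum>\<^sub>\<infinity>l. x l * mat_op N c l) = (\<Sum>\<^sub>\<infinity>j. mat_op (\<lambda>j l. N l j) x j * c j)"
proof -
  let ?S = "\<lambda>G. \<Sum>j\<in>G. mat_op (\<lambda>j l. N l j) x j * c j"
  let ?t = "\<lambda>G j. if j \<in> G then 0 else c j"
  have K: "0 \<le> K" using N by (simp add: form_bound_def)
  have lim: "(?S \<longlongrightarrow> (\<Sum>\<^sub>\<infinity>j. mat_op (\<lambda>j l. N l j) x j * c j)) (finite_subsets_at_top UNIV)"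
    by (intro infsum_tendsto ell2_mult_summable c form_bound_mat_op(1)[OF form_bound_transpose[OF N]] x)
  \<comment> \<open>The formula is exact for the truncation \<open>e\<close> of \<open>c\<close> to
    \<open>G\<close>. The error of the partial sum is therefore the pairing of \<open>x\<close> with
    the image of the tail, and Cauchy-Schwarz applies.\<close>
  have bound: "cmod (?S G - (\<Sum>\<^sub>\<infinity>l. x l * mat_op N c l)) \<le> ell2_norm x * (K * ell2_norm (?t G))"
    if G: "finite G" for G
  proof -
    define e where "e = (\<lambda>j. if j \<in> G then c j else 0)"
    have e: "e \<in> ell2" using ell2_norm_finite[OF G, of e] by (auto simp: e_def)
    have "?t G = c + (\<lambda>j. (-1) * e j)" by (auto simp: e_def fun_eq_iff)
    then have t: "?t G \<in> ell2" using c e ell2_scale ell2_add by metis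
    have ce: "c = e + ?t G" by (auto simp: e_def fun_eq_iff)
    have Ne: "mat_op N e l = (\<Sum>j\<in>G. N l j * c j)" for l
      unfolding mat_op_def e_def
      by (intro infsumI has_sum_finite_neutralI[OF G]) auto
    have "?S G = (\<Sum>j\<in>G. \<Sum>\<^sub>\<infinity>l. x l * N l j * c j)"
      unfolding mat_op_def by (subst infsum_cmult_left'[symmetric]) (simp add: mult_ac)
    also have "\<dots> = (\<Sum>\<^sub>\<infinity>l. \<Sum>j\<in>G. x l * N l j * c j)"
      by (intro infsum_finite_sum[symmetric] G summable_on_cmult_left ell2_mult_summable x form_bound_column[OF N])
    also have "\<dots> = (\<Sum>\<^sub>\<infinity>l. x l * mat_op N e l)"
      by (simp add: Ne sum_distrib_left mult.assoc)
    finally have S: "?S G = (\<Sum>\<^sub>\<infinity>l. x l * mat_op N e l)" .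
    have "(\<Sum>\<^sub>\<infinity>l. x l * mat_op N c l) = (\<Sum>\<^sub>\<infinity>l. x l * mat_op N e l + x l * mat_op N (?t G) l)"
      by (subst ce, subst mat_op_add[OF N e t]) (simp add: algebra_simps)
    also have "\<dots> = (\<Sum>\<^sub>\<infinity>l. x l * mat_op N e l) + (\<Sum>\<^sub>\<infinity>l. x l * mat_op N (?t G) l)"
      by (intro infsum_add ell2_mult_summable x form_bound_mat_op[OF N] e t)
    finally have "cmod (?S G - (\<Sum>\<^sub>\<infinity>l. x l * mat_op N c l)) = cmod (\<Sum>\<^sub>\<infinity>l. x l * mat_op N (?t G) l)"
      by (simp add: S)
    also have "\<dots> \<le> ell2_norm x * ell2_norm (mat_op N (?t G))"
      by (intro ell2_mult x form_bound_mat_op[OF N] t)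
    also have "\<dots> \<le> ell2_norm x * (K * ell2_norm (?t G))"
      by (intro mult_left_mono form_bound_mat_op[OF N] t) auto
    finally show ?thesis .
  qed
  have "((\<lambda>G. ?S G - (\<Sum>\<^sub>\<infinity>l. x l * mat_op N c l)) \<longlongrightarrow> 0) (finite_subsets_at_top UNIV)"
  proof (rule Lim_null_comparison)
    show "\<forall>\<^sub>F G in finite_subsets_at_top UNIV.
        norm (?S G - (\<Sum>\<^sub>\<infinity>l. x l * mat_op N c l)) \<le> ell2_norm x * (K * ell2_norm (?t G))"
      by (rule eventually_finite_subsets_at_top_weakI) (use bound in auto)
    show "((\<lambda>G. ell2_norm x * (K * ell2_norm (?t G))) \<longlongrightarrow> 0) (finite_subsets_at_top UNIV)"
      by (intro tendsto_mult_right_zero ell2_tail_tendsto_0 c)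
  qed
  then have "(?S \<longlongrightarrow> (\<Sum>\<^sub>\<infinity>l. x l * mat_op N c l)) (finite_subsets_at_top UNIV)"
    by (simp add: LIM_zero_iff)
  from tendsto_unique[OF _ this lim] show ?thesis by simp
qed

text \<open>Both sides pair row \<open>i\<close> of \<open>M\<close> with column \<open>j\<close> of
  \<open>P\<close> through \<open>N\<close>; they differ only in the side of the pairing on which
  \<open>N\<close> acts.\<close>

lemma mat_mult_assoc:
  assumes M: "form_bound M K" and N: "form_bound N L" and P: "form_bound P J"
  shows "mat_mult (mat_mult M N) P = mat_mult M (mat_mult N P)"
proof (intro ext)
  fix i j
  have "mat_mult M (mat_mult N P) i j = (\<Sum>\<^sub>\<infinity>l. M i l * mat_op N (\<lambda>h. P h j) l)"
    by (simp add: mat_mult_def mat_op_def)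
  also have "\<dots> = (\<Sum>\<^sub>\<infinity>h. mat_op (\<lambda>j l. N l j) (M i) h * P h j)"
    by (rule mat_op_transpose[OF N]) (intro form_bound_row[OF M] form_bound_column[OF P])+
  also have "\<dots> = mat_mult (mat_mult M N) P i j"
    by (simp add: mat_mult_def mat_op_def mult.commute)
  finally show "mat_mult (mat_mult M N) P i j = mat_mult M (mat_mult N P) i j" by simp
qed

text \<open>The form of the product pairs \<open>u\<close>, the transpose of \<open>M\<close>
  applied to \<open>d\<close>, with \<open>v\<close>, which is \<open>N\<close> applied to
  \<open>c\<close>. Cauchy-Schwarz then multiplies the bounds of the two factors.\<close>

lemma form_bound_mat_mult:
  assumes M: "form_bound M K" and N: "form_bound N L"
  shows "form_bound (mat_mult M N) (K * L)"
  unfolding form_bound_def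
proof (intro conjI allI impI)
  have K: "0 \<le> K" "0 \<le> L" using M N by (auto simp: form_bound_def)
  then show "0 \<le> K * L" by simp
  fix F G :: "'a set" and c d :: "'a \<Rightarrow> complex" assume fin: "finite F" "finite G"
  define u where "u = (\<lambda>l. \<Sum>i\<in>F. M i l * d i)"
  define v where "v = (\<lambda>l. \<Sum>j\<in>G. N l j * c j)"
  have "L2_set (\<lambda>l. cmod (u l)) H \<le> K * L2_set (\<lambda>i. cmod (d i)) F" if "finite H" for H
    unfolding u_def using form_bound_L2_set[OF form_bound_transpose[OF M] that fin(1)] .
  note u = ell2I_bound[OF this]
  have "L2_set (\<lambda>l. cmod (v l)) H \<le> L * L2_set (\<lambda>i. cmod (c i)) G" if "finite H" for H
    unfolding v_def using form_bound_L2_set[OF N that fin(2)] .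
  note v = ell2I_bound[OF this]
  have s: "(\<lambda>l. M i l * N l j) summable_on UNIV" for i j
    by (intro ell2_mult_summable form_bound_row[OF M] form_bound_column[OF N])
  have "(\<Sum>i\<in>F. \<Sum>j\<in>G. d i * mat_mult M N i j * c j)
      = (\<Sum>i\<in>F. \<Sum>j\<in>G. \<Sum>\<^sub>\<infinity>l. d i * (M i l * N l j) * c j)"
    by (simp add: mat_mult_def infsum_cmult_left' infsum_cmult_right')
  also have "\<dots> = (\<Sum>i\<in>F. \<Sum>\<^sub>\<infinity>l. \<Sum>j\<in>G. d i * (M i l * N l j) * c j)"
    by (intro sum.cong refl infsum_finite_sum[symmetric] fin summable_on_cmult_left summable_on_cmult_right s)
  also have "\<dots> = (\<Sum>\<^sub>\<infinity>l. \<Sum>i\<in>F. \<Sum>j\<in>G. d i * (M i l * N l j) * c j)"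
    by (intro infsum_finite_sum[symmetric] fin summable_on_finite_sum summable_on_cmult_left summable_on_cmult_right s)
  also have "\<dots> = (\<Sum>\<^sub>\<infinity>l. u l * v l)"
    unfolding u_def v_def sum_product by (simp add: mult_ac)
  finally have "cmod (\<Sum>i\<in>F. \<Sum>j\<in>G. d i * mat_mult M N i j * c j) \<le> ell2_norm u * ell2_norm v"
    using ell2_mult(2)[OF u(1) v(1)] by simp
  also have "\<dots> \<le> (K * L2_set (\<lambda>i. cmod (d i)) F) * (L * L2_set (\<lambda>i. cmod (c i)) G)"
    using u v K by (intro mult_mono) (auto simp: L2_set_nonneg)
  finally show "cmod (\<Sum>i\<in>F. \<Sum>j\<in>G. d i * mat_mult M N i j * c j)
      \<le> K * L * L2_set (\<lambda>i. cmod (d i)) F * L2_set (\<lambda>j. cmod (c j)) G"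
    by (simp add: mult_ac)
qed

lemma form_bound_sum:
  assumes "finite A" "\<And>m. m \<in> A \<Longrightarrow> form_bound (X m) (q m)"
  shows "form_bound (\<lambda>i j. \<Sum>m\<in>A. X m i j) (\<Sum>m\<in>A. q m)"
  using assms
proof (induction A rule: finite_induct)
  case empty
  show ?case by (simp add: form_bound_def)
next
  case (insert x A)
  then show ?case
    using form_bound_add[of "X x" "q x" "\<lambda>i j. \<Sum>m\<in>A. X m i j" "\<Sum>m\<in>A. q m"]
    by (simp add: plus_fun_def)
qed

text \<open>Intended for a block of a product of tensors, which is an infinite entrywise sum of
  products of blocks. Finite partial sums obey the finite version, and form bounds survive entrywise
  limits.\<close>

lemma form_bound_infsum:
  assumes "\<And>m. form_bound (X m) (q m)" "\<And>i j. (\<lambda>m. X m i j) summable_on UNIV" "q summable_on UNIV"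
  shows "form_bound (\<lambda>i j. \<Sum>\<^sub>\<infinity>m. X m i j) (\<Sum>\<^sub>\<infinity>m. q m)"
proof (rule form_bound_tendsto)
  show "((\<lambda>A. \<Sum>m\<in>A. X m i j) \<longlongrightarrow> (\<Sum>\<^sub>\<infinity>m. X m i j)) (finite_subsets_at_top UNIV)" for i j
    by (rule infsum_tendsto[OF assms(2)])
  show "((\<lambda>A. \<Sum>m\<in>A. q m) \<longlongrightarrow> (\<Sum>\<^sub>\<infinity>m. q m)) (finite_subsets_at_top UNIV)"
    by (rule infsum_tendsto[OF assms(3)])
  show "\<forall>\<^sub>F A in finite_subsets_at_top UNIV. form_bound (\<lambda>i j. \<Sum>m\<in>A. X m i j) (\<Sum>m\<in>A. q m)"
    by (rule eventually_finite_subsets_at_top_weakI) (intro form_bound_sum assms)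
qed simp

section \<open>The tensor algebra over one solid matrix algebra\<close>

lemma op_norm_nonneg: "bounded_mat M \<Longrightarrow> 0 \<le> op_norm (mat_op M)"
  by (rule form_boundD(1)[OF bounded_mat_form_bound])

lemma op_norm_add:
  assumes "bounded_mat M" "bounded_mat N"
  shows "op_norm (mat_op (M + N)) \<le> op_norm (mat_op M) + op_norm (mat_op N)"
  by (intro form_bound_imp_bounded_mat(2) form_bound_add bounded_mat_form_bound assms)

lemma bounded_mat_diff:
  assumes "bounded_mat M" "bounded_mat N"
  shows "bounded_mat (M - N)"
proof -
  have "M - N = M + mat_scale (-1) N" by (simp add: fun_eq_iff mat_scale_def)
  moreover have "bounded_mat (M + mat_scale (-1) N)"
    by (rule form_bound_imp_bounded_mat(1)[OF form_bound_add[OF assms(1)[THEN bounded_mat_form_bound]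
          form_bound_scale[OF assms(2)[THEN bounded_mat_form_bound]]]])
  ultimately show ?thesis by metis
qed

lemma bounded_mat_scale: "bounded_mat M \<Longrightarrow> bounded_mat (mat_scale a M)"
  by (rule form_bound_imp_bounded_mat(1)[OF form_bound_scale[OF bounded_mat_form_bound]])

text \<open>For nonzero \<open>a\<close> the reverse inequality is the direct one applied to
  \<open>mat_scale a M\<close> with the scalar \<open>1 / a\<close>.\<close>

lemma op_norm_scale:
  assumes "bounded_mat M"
  shows "op_norm (mat_op (mat_scale a M)) = cmod a * op_norm (mat_op M)"
proof -
  have le: "op_norm (mat_op (mat_scale b N)) \<le> cmod b * op_norm (mat_op N)" if "bounded_mat N" for b and N :: "'a cmat"
    by (intro form_bound_imp_bounded_mat(2) form_bound_scale bounded_mat_form_bound that)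
  show ?thesis
  proof (cases "a = 0")
    case True
    have "bounded_mat (mat_scale a M)"
      using assms by (rule bounded_mat_scale)
    then show ?thesis using le[OF assms, of a] True op_norm_nonneg[of "mat_scale a M"] by simp
  next
    case False
    then have "M = mat_scale (1 / a) (mat_scale a M)" by (simp add: mat_scale_def)
    moreover have "bounded_mat (mat_scale a M)"
      using assms by (rule bounded_mat_scale)
    ultimately have "op_norm (mat_op M) \<le> cmod (1 / a) * op_norm (mat_op (mat_scale a M))"
      using le by metis
    then have "cmod a * op_norm (mat_op M) \<le> op_norm (mat_op (mat_scale a M))"
      using False by (simp add: norm_divide field_simps)
    with le[OF assms, of a] show ?thesis by simp
  qed
qed

lemma mat_adj_mat_adj [simp]: "mat_adj (mat_adj M) = M"
  by (simp add: mat_adj_def)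

text \<open>The inequality for \<open>M\<close>, applied once more to its adjoint, becomes an
  equality because the adjoint is involutive.\<close>

lemma bounded_mat_adj:
  assumes "bounded_mat M"
  shows "bounded_mat (mat_adj M)" and "op_norm (mat_op (mat_adj M)) = op_norm (mat_op M)"
proof -
  have *: "bounded_mat (mat_adj N) \<and> op_norm (mat_op (mat_adj N)) \<le> op_norm (mat_op N)"
    if "bounded_mat N" for N :: "'a cmat"
    using form_bound_imp_bounded_mat[OF form_bound_adj[OF bounded_mat_form_bound[OF that]]] by simp
  show "bounded_mat (mat_adj M)" using * assms by blast
  show "op_norm (mat_op (mat_adj M)) = op_norm (mat_op M)"
    using *[OF assms] *[of "mat_adj M"] by simp
qed

section \<open>Blocks of a tensor and the matrix of their norms\<close>

definition block :: "('i, 'k) tensor \<Rightarrow> 'i \<Rightarrow> 'i \<Rightarrow> 'k cmat" where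
  "block A i j = (\<lambda>k l. A i k l j)"

text \<open>The matrix called \<open>Q\<close> in \<open>block_norm\<close>. The norms are embedded
  into the complex numbers because the members of the algebra are complex matrices.\<close>

definition block_norms :: "('i, 'k) tensor \<Rightarrow> 'i cmat" where
  "block_norms A = (\<lambda>i j. complex_of_real (op_norm (mat_op (block A i j))))"

lemma block_add: "block (A + B) i j = block A i j + block B i j"
  by (simp add: block_def fun_eq_iff)

lemma block_diff: "block (A - B) i j = block A i j - block B i j"
  by (simp add: block_def fun_eq_iff)

lemma block_scale: "block (tens_scale a A) i j = mat_scale a (block A i j)"
  by (simp add: block_def tens_scale_def mat_scale_def)

lemma block_adj: "block (tens_adj A) i j = mat_adj (block A j i)"
  by (simp add: block_def tens_adj_def mat_adj_def)

lemma tilde1_iff: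
  "A \<in> tilde1 S nrm \<longleftrightarrow> (\<forall>i j. bounded_mat (block A i j)) \<and> block_norms A \<in> S"
  by (simp add: tilde1_def tilde_norm1_def block_norm_def block_norms_def block_def Let_def)

lemma tilde_norm1_eq:
  "A \<in> tilde1 S nrm \<Longrightarrow> tilde_norm1 S nrm A = ereal (nrm (block_norms A))"
  by (auto simp: tilde1_def tilde_norm1_def block_norm_def block_norms_def block_def Let_def split: if_splits)

lemma cmod_block_norms: "bounded_mat (block A i j) \<Longrightarrow> cmod (block_norms A i j) = op_norm (mat_op (block A i j))"
  by (simp add: block_norms_def op_norm_nonneg)

lemma tilde1_form_bound:
  "A \<in> tilde1 S nrm \<Longrightarrow> form_bound (block A i j) (cmod (block_norms A i j))"
  by (simp add: tilde1_iff cmod_block_norms bounded_mat_form_bound)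

lemma cmod_entry_le_block_norms:
  "A \<in> tilde1 S nrm \<Longrightarrow> cmod (A i k l j) \<le> cmod (block_norms A i j)"
  using form_bound_entry[OF tilde1_form_bound, of A S nrm i j k l] by (simp add: block_def)

lemma vector_space_tens_scale: "vector_space tens_scale"
  by unfold_locales (auto simp: tens_scale_def fun_eq_iff algebra_simps)

section \<open>Convergence of the tensor product and its matrix\<close>

lemma tens_mult_summable:
  assumes "bounded_mat (tens_mat A)" "bounded_mat (tens_mat B)"
  shows "(\<lambda>(m, n). A i k n m * B m n l j) summable_on UNIV"
proof -
  \<comment> \<open>The double series pairs a row of one matrix with a column of the other, both
    square-summable over pairs of indices.\<close>
  have "tens_mat A (i, k) \<in> ell2" "(\<lambda>x. tens_mat B x (j, l)) \<in> ell2"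
    using form_bound_row(1)[OF bounded_mat_form_bound[OF assms(1)]]
      form_bound_column(1)[OF bounded_mat_form_bound[OF assms(2)]] by auto
  from ell2_mult_summable[OF this] show ?thesis
    by (simp add: tens_mat_def case_prod_unfold)
qed

lemma tens_mult_summable_swap:
  assumes "bounded_mat (tens_mat A)" "bounded_mat (tens_mat B)"
  shows "(\<lambda>(n, m). A i k n m * B m n l j) summable_on UNIV"
  using tens_mult_summable[OF assms, of i k l j]
    summable_on_swap[of "\<lambda>(m, n). A i k n m * B m n l j" UNIV UNIV] by simp

text \<open>Fubini for the absolutely summable double series. The order with \<open>m\<close>
  outside is the one in which blocks multiply like matrix entries.\<close>

lemma tens_mult_swap:
  assumes "bounded_mat (tens_mat A)" "bounded_mat (tens_mat B)"
  shows "tens_mult A B i k l j = (\<Sum>\<^sub>\<infinity>m. \<Sum>\<^sub>\<infinity>n. A i k n m * B m n l j)"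
  unfolding tens_mult_def
  by (rule infsum_swap_banach) (use tens_mult_summable_swap[OF assms] in simp)

text \<open>Reduces associativity of \<open>:\<close> to that of matrices over pairs.\<close>

lemma tens_mat_mult:
  assumes "bounded_mat (tens_mat A)" "bounded_mat (tens_mat B)"
  shows "tens_mat (tens_mult A B) = mat_mult (tens_mat A) (tens_mat B)"
proof -
  have "tens_mult A B i k l j = mat_mult (tens_mat A) (tens_mat B) (i, k) (j, l)" for i k l j
  proof -
    have "tens_mult A B i k l j = (\<Sum>\<^sub>\<infinity>m. \<Sum>\<^sub>\<infinity>n. A i k n m * B m n l j)"
      by (rule tens_mult_swap[OF assms])
    also have "\<dots> = (\<Sum>\<^sub>\<infinity>(m, n). A i k n m * B m n l j)"
      using infsum_Sigma'_banach[of "\<lambda>m n. A i k n m * B m n l j" UNIV "\<lambda>_. UNIV"]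
        tens_mult_summable[OF assms, of i k l j] by simp
    finally show ?thesis
      by (simp add: mat_mult_def tens_mat_def case_prod_unfold)
  qed
  then show ?thesis by (auto simp: fun_eq_iff tens_mat_def)
qed

text \<open>Lets tensor identities be checked on matrices, and makes the image of an intersection
  the intersection of the images.\<close>

lemma inj_tens_mat: "inj tens_mat"
proof (rule injI)
  fix A B :: "('i, 'k) tensor"
  assume "tens_mat A = tens_mat B"
  then have "tens_mat A (i, k) (j, l) = tens_mat B (i, k) (j, l)" for i k l j by simp
  then show "A = B" by (simp add: tens_mat_def fun_eq_iff)
qed

lemma bounded_mat_mult:
  "bounded_mat M \<Longrightarrow> bounded_mat N \<Longrightarrow> bounded_mat (mat_mult M N)"
  by (rule form_bound_imp_bounded_mat(1)[OF form_bound_mat_mult[OF bounded_mat_form_bound bounded_mat_form_bound]])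

lemma tens_mult_assoc:
  assumes "bounded_mat (tens_mat A)" "bounded_mat (tens_mat B)" "bounded_mat (tens_mat C)"
  shows "tens_mult (tens_mult A B) C = tens_mult A (tens_mult B C)"
proof -
  have "tens_mat (tens_mult (tens_mult A B) C) = tens_mat (tens_mult A (tens_mult B C))"
    using assms mat_mult_assoc[OF assms[THEN bounded_mat_form_bound]]
    by (simp add: tens_mat_mult bounded_mat_mult)
  then show ?thesis using inj_tens_mat by (auto dest: injD)
qed

section \<open>Solid algebras and the tensor norms they induce\<close>

locale solid_matrix_algebra = involutive_banach_algebra mat_scale S nrm mat_mult mat_adj
  for S :: "'i cmat set" and nrm :: "'i cmat \<Rightarrow> real" +
  assumes solid: "solid S nrm"
    and bounded: "M \<in> S \<Longrightarrow> bounded_mat M"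
begin

lemma solidD:
  assumes "M \<in> S" "\<And>i j. cmod (N i j) \<le> cmod (M i j)"
  shows "N \<in> S" and "nrm N \<le> nrm M"
  using solid assms unfolding solid_def by blast+

lemma diff_closed: "M \<in> S \<Longrightarrow> N \<in> S \<Longrightarrow> M - N \<in> S"
  using subspace_S by (rule subspace_diff)

lemma entry_le_nrm:
  obtains C where "0 \<le> C" "\<And>Q. Q \<in> S \<Longrightarrow> cmod (Q i j) \<le> C * nrm Q"
proof (cases "\<forall>Q\<in>S. Q i j = 0")
  case True
  then show ?thesis using that[of 0] by simp
next
  case False
  then obtain Q\<^sub>0 where Q0: "Q\<^sub>0 \<in> S" "Q\<^sub>0 i j \<noteq> 0" by blast
  define E where "E z = (\<lambda>a b. if a = i \<and> b = j then z else (0::complex))" for z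
  have E: "E (Q i j) \<in> S" "nrm (E (Q i j)) \<le> nrm Q" if "Q \<in> S" for Q
    by (rule solidD[OF that]; simp add: E_def)+
  have "E (Q\<^sub>0 i j) \<noteq> 0" using Q0(2) by (auto simp: E_def fun_eq_iff)
  then have pos: "0 < nrm (E (Q\<^sub>0 i j))"
    using nrm_nonneg nrm_eq_0_iff E(1)[OF Q0(1)] by (metis less_eq_real_def)
  show ?thesis
  \<comment> \<open>Matrices supported at the position (i,j) form a line, spanned by the truncation
    of \<open>Q\<^sub>0\<close>. The constant is the reciprocal of the norm of the matrix unit
    there, and solidity compares \<open>Q\<close> with its own truncation.\<close>
  proof (rule that[of "cmod (Q\<^sub>0 i j) / nrm (E (Q\<^sub>0 i j))"])
    show "0 \<le> cmod (Q\<^sub>0 i j) / nrm (E (Q\<^sub>0 i j))" using pos by simp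
    fix Q assume Q: "Q \<in> S"
    have "E (Q i j) = mat_scale (Q i j / Q\<^sub>0 i j) (E (Q\<^sub>0 i j))"
      using Q0(2) by (simp add: E_def mat_scale_def fun_eq_iff)
    then have "cmod (Q i j / Q\<^sub>0 i j) * nrm (E (Q\<^sub>0 i j)) \<le> nrm Q"
      using E(2)[OF Q] nrm_scale[OF E(1)[OF Q0(1)]] by simp
    then show "cmod (Q i j) \<le> cmod (Q\<^sub>0 i j) / nrm (E (Q\<^sub>0 i j)) * nrm Q"
      using pos Q0(2) by (simp add: norm_divide field_simps)
  qed
qed

lemma nrm_tendsto_entry:
  assumes "\<And>n. Q n - L \<in> S" "(\<lambda>n. nrm (Q n - L)) \<longlonglongrightarrow> 0"
  shows "(\<lambda>n. Q n i j) \<longlonglongrightarrow> L i j"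
proof -
  obtain C where C: "\<And>Q. Q \<in> S \<Longrightarrow> cmod (Q i j) \<le> C * nrm Q" using entry_le_nrm by metis
  have "(\<lambda>n. Q n i j - L i j) \<longlonglongrightarrow> 0"
  proof (rule Lim_null_comparison)
    show "\<forall>\<^sub>F n in sequentially. norm (Q n i j - L i j) \<le> C * nrm (Q n - L)"
      using C[OF assms(1)] by simp
    show "(\<lambda>n. C * nrm (Q n - L)) \<longlonglongrightarrow> 0"
      by (intro tendsto_mult_right_zero assms)
  qed
  then show ?thesis by (simp add: LIM_zero_iff)
qed

text \<open>The common source of membership and norm estimates for sums, products and limits: any
  form bounds of the blocks will do, provided a matrix \<open>P\<close> in the algebra dominates
  them.\<close>

lemma tilde1I:
  assumes "\<And>i j. form_bound (block A i j) (q i j)" "\<And>i j. q i j \<le> cmod (P i j)" "P \<in> S"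
  shows "A \<in> tilde1 S nrm" and "nrm (block_norms A) \<le> nrm P"
proof -
  have b: "bounded_mat (block A i j)" for i j
    by (rule form_bound_imp_bounded_mat(1)[OF assms(1)])
  have "cmod (block_norms A i j) \<le> cmod (P i j)" for i j
    using form_bound_imp_bounded_mat(2)[OF assms(1)] assms(2) cmod_block_norms[OF b]
    by (metis order_trans)
  from solidD[OF assms(3) this] b show "A \<in> tilde1 S nrm" "nrm (block_norms A) \<le> nrm P"
    by (auto simp: tilde1_iff)
qed

lemma tilde1_zero: "0 \<in> tilde1 S nrm"
proof (rule tilde1I)
  show "form_bound (block (0 :: ('i, 'k) tensor) i j) 0" for i j
    by (simp add: form_bound_def block_def)
  show "0 \<in> S" by (rule subspace_0[OF subspace_S])
qed simp

lemma tilde1_add: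
  assumes A: "A \<in> tilde1 S nrm" and B: "B \<in> tilde1 S nrm"
  shows "A + B \<in> tilde1 S nrm"
    and "nrm (block_norms (A + B)) \<le> nrm (block_norms A) + nrm (block_norms B)"
proof -
  have S: "block_norms A \<in> S" "block_norms B \<in> S" using A B by (auto simp: tilde1_iff)
  have 1: "form_bound (block (A + B) i j) (cmod (block_norms A i j) + cmod (block_norms B i j))" for i j
    unfolding block_add by (intro form_bound_add tilde1_form_bound[OF A] tilde1_form_bound[OF B])
  have 2: "cmod (block_norms A i j) + cmod (block_norms B i j) \<le> cmod ((block_norms A + block_norms B) i j)"
    for i j
  proof -
    have "0 \<le> op_norm (mat_op (block A i j))" "0 \<le> op_norm (mat_op (block B i j))"
      using A B by (auto simp: tilde1_iff op_norm_nonneg)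
    then show ?thesis by (simp add: block_norms_def flip: of_real_add)
  qed
  have 3: "block_norms A + block_norms B \<in> S"
    by (rule subspace_add[OF subspace_S S])
  show "A + B \<in> tilde1 S nrm"
    and "nrm (block_norms (A + B)) \<le> nrm (block_norms A) + nrm (block_norms B)"
    using tilde1I[OF 1 2 3] nrm_triangle[OF S] by auto
qed

lemma tilde1_scale:
  assumes A: "A \<in> tilde1 S nrm"
  shows "tens_scale a A \<in> tilde1 S nrm"
    and "nrm (block_norms (tens_scale a A)) = cmod a * nrm (block_norms A)"
proof -
  have S: "block_norms A \<in> S" "\<And>i j. bounded_mat (block A i j)" using A by (auto simp: tilde1_iff)
  have eq: "block_norms (tens_scale a A) = mat_scale (complex_of_real (cmod a)) (block_norms A)"
    using S(2) by (simp add: block_norms_def block_scale op_norm_scale mat_scale_def[of "complex_of_real (cmod a)"])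
  have "bounded_mat (block (tens_scale a A) i j)" for i j
    unfolding block_scale
    by (intro bounded_mat_scale S)
  then show "tens_scale a A \<in> tilde1 S nrm"
    using subspace_scale[OF subspace_S S(1)] by (simp add: tilde1_iff eq)
  show "nrm (block_norms (tens_scale a A)) = cmod a * nrm (block_norms A)"
    using nrm_scale[OF S(1)] by (simp add: eq)
qed

lemma tilde1_diff:
  assumes "A \<in> tilde1 S nrm" "B \<in> tilde1 S nrm"
  shows "A - B \<in> tilde1 S nrm"
proof -
  have "A - B = A + tens_scale (-1) B" by (simp add: fun_eq_iff tens_scale_def)
  then show ?thesis using tilde1_add tilde1_scale assms by metis
qed

text \<open>The adjoint exchanges the blocks (i,j) and (j,i) and takes the adjoint of each. As block
  norms are real, their matrix simply passes to its adjoint.\<close>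

lemma tilde1_adj:
  assumes "A \<in> tilde1 S nrm"
  shows "tens_adj A \<in> tilde1 S nrm" and "nrm (block_norms (tens_adj A)) = nrm (block_norms A)"
proof -
  have S: "block_norms A \<in> S" "\<And>i j. bounded_mat (block A i j)" using assms by (auto simp: tilde1_iff)
  have eq: "block_norms (tens_adj A) = mat_adj (block_norms A)"
    unfolding mat_adj_def[of "block_norms A"]
    using S(2) by (simp add: block_norms_def block_adj bounded_mat_adj)
  show "tens_adj A \<in> tilde1 S nrm" "nrm (block_norms (tens_adj A)) = nrm (block_norms A)"
    using S star_closed nrm_star by (auto simp: tilde1_iff eq block_adj bounded_mat_adj)
qed

lemma tilde1_mult:
  assumes A: "A \<in> tilde1 S nrm" "bounded_mat (tens_mat A)"
    and B: "B \<in> tilde1 S nrm" "bounded_mat (tens_mat B)"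
  shows "tens_mult A B \<in> tilde1 S nrm"
    and "nrm (block_norms (tens_mult A B)) \<le> nrm (block_norms A) * nrm (block_norms B)"
proof -
  have S: "block_norms A \<in> S" "block_norms B \<in> S" using A B by (auto simp: tilde1_iff)
  let ?q = "\<lambda>i j m. cmod (block_norms A i m) * cmod (block_norms B m j)"
  \<comment> \<open>Members of \<open>S\<close> act boundedly, so the rows and columns of the two
    matrices of block norms are square-summable.\<close>
  have s: "?q i j summable_on UNIV" for i j
    using ell2_mult(1)[OF form_bound_row(1) form_bound_column(1), OF S[THEN bounded, THEN bounded_mat_form_bound]]
    by (simp add: norm_mult)
  have fb: "form_bound (mat_mult (block A i m) (block B m j)) (?q i j m)" for i j m
    by (intro form_bound_mat_mult tilde1_form_bound[OF A(1)] tilde1_form_bound[OF B(1)])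
  \<comment> \<open>Summing over \<open>m\<close> outside exhibits the block as a sum of products of
    blocks, each with form bound \<open>?q i j m\<close>.\<close>
  have "block (tens_mult A B) i j = (\<lambda>k l. \<Sum>\<^sub>\<infinity>m. mat_mult (block A i m) (block B m j) k l)" for i j
    by (simp add: block_def tens_mult_swap[OF A(2) B(2)] mat_mult_def)
  moreover have "(\<lambda>m. mat_mult (block A i m) (block B m j) k l) summable_on UNIV" for i j k l
    by (rule Infinite_Sum.abs_summable_summable, rule Infinite_Sum.abs_summable_on_comparison_test'[OF s[of i j]])
      (rule form_bound_entry[OF fb])
  ultimately have 1: "form_bound (block (tens_mult A B) i j) (\<Sum>\<^sub>\<infinity>m. ?q i j m)" for i j
    using form_bound_infsum[OF fb _ s, of i j] by simp
  \<comment> \<open>The factors are nonnegative reals, so passing to moduli loses nothing in the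
    product of the matrices of block norms.\<close>
  have 2: "(\<Sum>\<^sub>\<infinity>m. ?q i j m) \<le> cmod (mat_mult (block_norms A) (block_norms B) i j)" for i j
  proof -
    have "0 \<le> op_norm (mat_op (block A i m))" "0 \<le> op_norm (mat_op (block B m j))" for m
      using A B by (auto simp: tilde1_iff op_norm_nonneg)
    then have "mat_mult (block_norms A) (block_norms B) i j = (\<Sum>\<^sub>\<infinity>m. complex_of_real (?q i j m))"
      by (simp add: mat_mult_def block_norms_def)
    also have "\<dots> = complex_of_real (\<Sum>\<^sub>\<infinity>m. ?q i j m)"
      by (rule infsumI) (intro has_sum_of_real has_sum_infsum s)
    finally have "cmod (mat_mult (block_norms A) (block_norms B) i j) = \<bar>\<Sum>\<^sub>\<infinity>m. ?q i j m\<bar>"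
      by (simp only: norm_of_real)
    then show ?thesis by linarith
  qed
  from tilde1I[OF 1 2 mul_closed[OF S]] nrm_mul[OF S]
  show "tens_mult A B \<in> tilde1 S nrm"
    and "nrm (block_norms (tens_mult A B)) \<le> nrm (block_norms A) * nrm (block_norms B)"
    by auto
qed

text \<open>The block norms of \<open>X n\<close> form a Cauchy sequence in \<open>S\<close>, hence
  have a limit \<open>P\<close> there. Form bounds survive entrywise limits, so the blocks of
  \<open>L\<close> are dominated by \<open>P\<close>; domination is all that solidity asks
  for.\<close>

lemma tilde1_limit:
  assumes X: "\<And>n. X n \<in> tilde1 S nrm"
    and cauchy: "\<And>e. e > 0 \<Longrightarrow> \<exists>N. \<forall>m\<ge>N. \<forall>n\<ge>N. nrm (block_norms (X m - X n)) < e"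
    and lim: "\<And>i k l j. (\<lambda>n. X n i k l j) \<longlonglongrightarrow> L i k l j"
    and le: "\<forall>\<^sub>F n in sequentially. nrm (block_norms (X n)) \<le> e"
  shows "L \<in> tilde1 S nrm" and "nrm (block_norms L) \<le> e"
proof -
  let ?Q = "\<lambda>n. block_norms (X n)"
  have Q: "?Q n \<in> S" "bounded_mat (block (X n) i j)" for n i j using X by (auto simp: tilde1_iff)
  \<comment> \<open>The reverse triangle inequality for operator norms, entry by entry; solidity
    then turns it into an inequality between norms in \<open>S\<close>.\<close>
  have ent: "cmod ((?Q m - ?Q n) i j) \<le> cmod (block_norms (X m - X n) i j)" for m n i j
  proof -
    let ?n = "\<lambda>A. op_norm (mat_op (block A i j))"
    have bd: "bounded_mat (block (X m - X n) i j)" for m n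
      unfolding block_diff by (intro bounded_mat_diff Q)
    have tri: "?n (X a) \<le> ?n (X b) + ?n (X a - X b)" for a b
      using op_norm_add[OF Q(2)[of b i j] bd[of a b]] by (simp add: block_diff)
    have "?n (X n - X m) = ?n (X m - X n)"
      using op_norm_scale[OF bd, of "-1" m n]
      by (simp add: block_def mat_scale_def)
    then have "\<bar>?n (X m) - ?n (X n)\<bar> \<le> ?n (X m - X n)"
      using tri[of m n] tri[of n m] by linarith
    then show ?thesis
      unfolding cmod_block_norms[OF bd]
      by (simp add: block_norms_def flip: of_real_diff)
  qed
  have Qle: "nrm (?Q m - ?Q n) \<le> nrm (block_norms (X m - X n))" for m n
    using tilde1_diff[OF X X, of m n] by (intro solidD(2)[OF _ ent]) (simp add: tilde1_iff)
  have "\<exists>P\<in>S. (\<lambda>n. nrm (?Q n - P)) \<longlonglongrightarrow> 0"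
  proof (rule complete)
    fix e :: real assume "0 < e"
    from cauchy[OF this] show "\<exists>N. \<forall>m\<ge>N. \<forall>n\<ge>N. nrm (?Q m - ?Q n) < e"
      by (meson Qle le_less_trans)
  qed (rule Q(1))
  then obtain P where P: "P \<in> S" "(\<lambda>n. nrm (?Q n - P)) \<longlonglongrightarrow> 0" by blast
  have QP: "?Q n - P \<in> S" for n using Q P by (intro diff_closed)
  have fb: "form_bound (block L i j) (cmod (P i j))" for i j
  proof (rule form_bound_tendsto[where H = sequentially])
    show "(\<lambda>n. block (X n) i j k l) \<longlonglongrightarrow> block L i j k l" for k l
      using lim by (simp add: block_def)
    show "(\<lambda>n. cmod (?Q n i j)) \<longlonglongrightarrow> cmod (P i j)"
      by (intro tendsto_norm nrm_tendsto_entry QP P)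
    show "\<forall>\<^sub>F n in sequentially. form_bound (block (X n) i j) (cmod (?Q n i j))"
      using tilde1_form_bound[OF X] by simp
  qed simp
  note L = tilde1I[OF fb order_refl P(1)]
  show "L \<in> tilde1 S nrm" by (rule L)
  \<comment> \<open>The bound \<open>e\<close> reaches \<open>P\<close> by subtracting
    \<open>?Q n - P\<close> from \<open>?Q n\<close>; the norm of the subtracted matrix tends to
    zero.\<close>
  have "nrm P \<le> e + 0"
  proof (rule tendsto_lowerbound)
    show "(\<lambda>n. e + nrm (?Q n - P)) \<longlonglongrightarrow> e + 0" by (intro tendsto_intros P)
    show "\<forall>\<^sub>F n in sequentially. nrm P \<le> e + nrm (?Q n - P)"
      using le
    proof eventually_elim
      case (elim n)
      have "nrm (?Q n + mat_scale (-1) (?Q n - P)) \<le> nrm (?Q n) + nrm (mat_scale (-1) (?Q n - P))"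
        by (intro nrm_triangle Q subspace_scale[OF subspace_S] QP)
      moreover have "?Q n + mat_scale (-1) (?Q n - P) = P"
        by (simp add: fun_eq_iff mat_scale_def)
      ultimately show ?case using elim nrm_scale[OF QP, of "-1" n] by simp
    qed
  qed simp
  with L(2) show "nrm (block_norms L) \<le> e" by simp
qed

text \<open>Norm convergence forces the block norm at (i,j) to zero, and that norm bounds every
  entry of the block. Only the differences are assumed to lie in the algebra.\<close>

lemma tilde1_tendsto_entry:
  assumes "\<And>n. X n - L \<in> tilde1 S nrm" "(\<lambda>n. nrm (block_norms (X n - L))) \<longlonglongrightarrow> 0"
  shows "(\<lambda>n. X n i k l j) \<longlonglongrightarrow> L i k l j"
proof -
  have "block_norms (X n - L) \<in> S" for n using assms(1) by (simp only: tilde1_iff)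
  then have "(\<lambda>n. block_norms (X n - L) i j) \<longlonglongrightarrow> (0 :: 'i cmat) i j"
    using nrm_tendsto_entry[of "\<lambda>n. block_norms (X n - L)" 0 i j] assms(2) by (simp only: diff_zero)
  then have "(\<lambda>n. cmod (block_norms (X n - L) i j)) \<longlonglongrightarrow> 0"
    by (simp add: tendsto_norm_zero)
  then have "(\<lambda>n. X n i k l j - L i k l j) \<longlonglongrightarrow> 0"
    by (rule Lim_null_comparison[rotated])
      (use cmod_entry_le_block_norms[OF assms(1)] in auto)
  then show ?thesis by (simp add: LIM_zero_iff)
qed

lemma tilde1_complete:
  assumes X: "\<And>n. X n \<in> tilde1 S nrm"
    and cauchy: "\<And>e. e > 0 \<Longrightarrow> \<exists>N. \<forall>m\<ge>N. \<forall>n\<ge>N. nrm (block_norms (X m - X n)) < e"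
  shows "\<exists>L\<in>tilde1 S nrm. (\<lambda>n. nrm (block_norms (X n - L))) \<longlonglongrightarrow> 0"
proof -
  have "Cauchy (\<lambda>n. X n i k l j)" for i k l j
  proof (rule metric_CauchyI)
    fix e :: real assume e: "e > 0"
    obtain C where C: "0 \<le> C" "\<And>Q. Q \<in> S \<Longrightarrow> cmod (Q i j) \<le> C * nrm Q" using entry_le_nrm by metis
    \<comment> \<open>The divisor is \<open>C + 1\<close> since \<open>C\<close> is zero at a
      position where every member of \<open>S\<close> vanishes.\<close>
    from cauchy[of "e / (C + 1)"] C e obtain N
      where N: "\<And>m n. m \<ge> N \<Longrightarrow> n \<ge> N \<Longrightarrow> nrm (block_norms (X m - X n)) < e / (C + 1)"
      by (auto simp: add_nonneg_pos)
    have "dist (X m i k l j) (X n i k l j) < e" if "m \<ge> N" "n \<ge> N" for m n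
    proof -
      have D: "X m - X n \<in> tilde1 S nrm" by (intro tilde1_diff X)
      then have DS: "block_norms (X m - X n) \<in> S" by (simp add: tilde1_iff)
      have "dist (X m i k l j) (X n i k l j) \<le> cmod (block_norms (X m - X n) i j)"
        using cmod_entry_le_block_norms[OF D, of i k l j] by (simp add: dist_norm)
      also have "\<dots> \<le> C * nrm (block_norms (X m - X n))" by (rule C(2)[OF DS])
      also have "\<dots> \<le> (C + 1) * nrm (block_norms (X m - X n))"
        using nrm_nonneg[OF DS] by (simp add: algebra_simps)
      also have "\<dots> < (C + 1) * (e / (C + 1))"
        using N[OF that] C(1) by (intro mult_strict_left_mono) auto
      finally show ?thesis using C(1) by simp
    qed
    then show "\<exists>N. \<forall>m\<ge>N. \<forall>n\<ge>N. dist (X m i k l j) (X n i k l j) < e" by blast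
  qed
  then have "\<forall>i k l j. \<exists>z. (\<lambda>n. X n i k l j) \<longlonglongrightarrow> z"
    using Cauchy_convergent_iff convergent_def by blast
  then obtain L where L: "\<And>i k l j. (\<lambda>n. X n i k l j) \<longlonglongrightarrow> L i k l j" by metis
  \<comment> \<open>The limit lemma is applied in \<open>m\<close> to the differences
    \<open>X n - X m\<close> with \<open>n\<close> fixed, so that its bound becomes an estimate of
    the distance from \<open>X n\<close> to \<open>L\<close>.\<close>
  have *: "X n - L \<in> tilde1 S nrm \<and> nrm (block_norms (X n - L)) \<le> e"
    if N: "\<And>m n. m \<ge> N \<Longrightarrow> n \<ge> N \<Longrightarrow> nrm (block_norms (X m - X n)) < e" and "n \<ge> N" for n N e
  proof -
    have "\<exists>N. \<forall>m\<ge>N. \<forall>m'\<ge>N. nrm (block_norms ((X n - X m) - (X n - X m'))) < e" if "e > 0" for e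
      using cauchy[OF that] by auto
    moreover have "(\<lambda>m. (X n - X m) i k l j) \<longlonglongrightarrow> (X n - L) i k l j" for i k l j
      using L by (auto intro!: tendsto_intros)
    moreover have "\<forall>\<^sub>F m in sequentially. nrm (block_norms (X n - X m)) \<le> e"
      unfolding eventually_sequentially using N[OF \<open>n \<ge> N\<close>] less_imp_le by blast
    ultimately show ?thesis
      using tilde1_limit[of "\<lambda>m. X n - X m" "X n - L" e] tilde1_diff[OF X X] by blast
  qed
  \<comment> \<open>Any positive bound serves here: one difference \<open>X N - L\<close> inside the
    algebra puts \<open>L\<close> there as well.\<close>
  from cauchy[of 1] obtain N where N: "\<And>m n. m \<ge> N \<Longrightarrow> n \<ge> N \<Longrightarrow> nrm (block_norms (X m - X n)) < 1"
    by auto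
  from *[of N 1 N, OF N] have "X N - L \<in> tilde1 S nrm" by simp
  then have "X N - (X N - L) \<in> tilde1 S nrm" by (rule tilde1_diff[OF X])
  then have LS: "L \<in> tilde1 S nrm" by simp
  have "(\<lambda>n. nrm (block_norms (X n - L))) \<longlonglongrightarrow> 0"
  proof (rule LIMSEQ_I)
    fix r :: real assume "r > 0"
    \<comment> \<open>Limits preserve only the non-strict inequality; \<open>r / 2\<close> restores
      the strict one.\<close>
    then obtain N where N: "\<And>m n. m \<ge> N \<Longrightarrow> n \<ge> N \<Longrightarrow> nrm (block_norms (X m - X n)) < r / 2"
      using cauchy[of "r / 2"] by auto
    have "norm (nrm (block_norms (X n - L)) - 0) < r" if "n \<ge> N" for n
      using *[OF N that] nrm_nonneg[of "block_norms (X n - L)"] \<open>r > 0\<close> by (auto simp: tilde1_iff)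
    then show "\<exists>N. \<forall>n\<ge>N. norm (nrm (block_norms (X n - L)) - 0) < r" by blast
  qed
  with LS show ?thesis by blast
qed

lemma tilde1_nrm_eq_0_iff:
  assumes A: "A \<in> tilde1 S nrm"
  shows "nrm (block_norms A) = 0 \<longleftrightarrow> A = 0"
proof
  assume "nrm (block_norms A) = 0"
  then have "block_norms A = 0" using A nrm_eq_0_iff by (simp add: tilde1_iff)
  then have "A i k l j = 0" for i k l j using cmod_entry_le_block_norms[OF A, of i k l j] by simp
  then show "A = 0" by (simp add: fun_eq_iff)
next
  assume "A = 0"
  \<comment> \<open>A zero block is zero times itself, so homogeneity of the operator norm evaluates
    its norm.\<close>
  then have "block A i j = mat_scale 0 (block A i j)" for i j
    by (simp add: block_def mat_scale_def)
  then have "op_norm (mat_op (block A i j)) = 0" for i j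
    using op_norm_scale[of "block A i j" 0] A by (simp add: tilde1_iff)
  then have "block_norms A = 0" by (simp add: block_norms_def fun_eq_iff)
  then show "nrm (block_norms A) = 0" using A nrm_eq_0_iff by (simp add: tilde1_iff)
qed

text \<open>The assumption \<open>bd\<close> secures convergence of the double series in products;
  the theorem obtains it from \<open>tens_inverse_closed\<close>.\<close>

lemma involutive_banach_algebra_tilde1:
  assumes bd: "\<And>A. A \<in> (tilde1 S nrm :: ('i, 'k) tensor set) \<Longrightarrow> bounded_mat (tens_mat A)"
  shows "involutive_banach_algebra tens_scale (tilde1 S nrm :: ('i, 'k) tensor set)
    (\<lambda>A. nrm (block_norms A)) tens_mult tens_adj"
proof -
  interpret T: vector_space "tens_scale :: complex \<Rightarrow> ('i, 'k) tensor \<Rightarrow> _"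
    by (rule vector_space_tens_scale)
  show ?thesis
  proof unfold_locales
    show "T.subspace (tilde1 S nrm)"
      by (simp add: T.subspace_def tilde1_zero tilde1_add tilde1_scale)
  next
    fix A B C :: "('i, 'k) tensor" and a
    assume A: "A \<in> tilde1 S nrm"
    show "0 \<le> nrm (block_norms A)" using A nrm_nonneg by (simp add: tilde1_iff)
    show "nrm (block_norms A) = 0 \<longleftrightarrow> A = 0" using A by (rule tilde1_nrm_eq_0_iff)
    show "nrm (block_norms (tens_scale a A)) = cmod a * nrm (block_norms A)"
      using A by (rule tilde1_scale)
    show "tens_adj A \<in> tilde1 S nrm" "nrm (block_norms (tens_adj A)) = nrm (block_norms A)"
      using A by (rule tilde1_adj)+
    show "tens_adj (tens_scale a A) = tens_scale (cnj a) (tens_adj A)"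
      by (simp add: tens_adj_def tens_scale_def)
    show "tens_adj (tens_adj A) = A" by (simp add: tens_adj_def)
    assume B: "B \<in> tilde1 S nrm"
    show "nrm (block_norms (A + B)) \<le> nrm (block_norms A) + nrm (block_norms B)"
      using A B by (rule tilde1_add)
    show "tens_mult A B \<in> tilde1 S nrm"
      "nrm (block_norms (tens_mult A B)) \<le> nrm (block_norms A) * nrm (block_norms B)"
      using tilde1_mult A B bd by blast+
    show "tens_mult (tens_scale a A) B = tens_scale a (tens_mult A B)"
      "tens_mult A (tens_scale a B) = tens_scale a (tens_mult A B)"
      by (simp_all add: tens_mult_def tens_scale_def mult.assoc mult.left_commute infsum_cmult_right')
    show "tens_adj (A + B) = tens_adj A + tens_adj B"
      by (simp add: tens_adj_def fun_eq_iff)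
    show "tens_adj (tens_mult A B) = tens_mult (tens_adj B) (tens_adj A)"
      by (simp add: tens_adj_def tens_mult_def mult.commute flip: infsum_cnj)
    assume C: "C \<in> tilde1 S nrm"
    show "tens_mult (tens_mult A B) C = tens_mult A (tens_mult B C)"
      using A B C bd by (intro tens_mult_assoc) auto
    \<comment> \<open>Distributivity splits both the inner and the outer sum, and each splitting
      needs convergence. Summability over pairs provides both.\<close>
    have s: "(\<lambda>(m, n). A i k n m * B m n l j) summable_on UNIV \<times> UNIV"
      if "A \<in> tilde1 S nrm" "B \<in> tilde1 S nrm" for A B :: "('i, 'k) tensor" and i k l j
      using tens_mult_summable[OF that[THEN bd]] by simp
    have sw: "tens_mult A B i k l j = (\<Sum>\<^sub>\<infinity>m. \<Sum>\<^sub>\<infinity>n. A i k n m * B m n l j)"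
      if "A \<in> tilde1 S nrm" "B \<in> tilde1 S nrm" for A B :: "('i, 'k) tensor" and i k l j
      using tens_mult_swap[OF that[THEN bd]] .
    have S1: "(\<lambda>n. A i k n m * B m n l j) summable_on UNIV"
      and S2: "(\<lambda>m. \<Sum>\<^sub>\<infinity>n. A i k n m * B m n l j) summable_on UNIV"
      if "A \<in> tilde1 S nrm" "B \<in> tilde1 S nrm" for A B :: "('i, 'k) tensor" and i k l j m
      using summable_on_SigmaD1[OF s[OF that]] summable_on_Sigma_banach[OF s[OF that]] by auto
    show "tens_mult (A + B) C = tens_mult A C + tens_mult B C"
      by (simp add: fun_eq_iff sw A B C tilde1_add distrib_right infsum_add S1 S2)
    show "tens_mult A (B + C) = tens_mult A B + tens_mult A C"
      by (simp add: fun_eq_iff sw A B C tilde1_add distrib_left infsum_add S1 S2)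
  next
    fix X :: "nat \<Rightarrow> ('i, 'k) tensor"
    assume "\<And>n. X n \<in> tilde1 S nrm"
      "\<And>e. 0 < e \<Longrightarrow> \<exists>N. \<forall>m\<ge>N. \<forall>n\<ge>N. nrm (block_norms (X m - X n)) < e"
    then show "\<exists>L\<in>tilde1 S nrm. (\<lambda>n. nrm (block_norms (X n - L))) \<longlonglongrightarrow> 0"
      by (rule tilde1_complete)
  qed
qed

end

section \<open>The intersection\<close>

text \<open>The inverse \<open>g\<close> gives injectivity of \<open>f\<close> and carries limits
  back. Compatibility of the products is asked on \<open>S\<close> only, because exchanging the two
  sums of a tensor product needs bounded factors.\<close>

lemma involutive_banach_algebra_pullback:
  assumes alg: "involutive_banach_algebra sc S nrm mul star"
    and vs: "vector_space sc'"
    and inv: "\<And>x. g (f x) = x" "\<And>y. f (g y) = y"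
    and add: "\<And>x y. f (x + y) = f x + f y"
    and scale: "\<And>a x. f (sc' a x) = sc a (f x)"
    and mul: "\<And>x y. f x \<in> S \<Longrightarrow> f y \<in> S \<Longrightarrow> f (mul' x y) = mul (f x) (f y)"
    and star: "\<And>x. f x \<in> S \<Longrightarrow> f (star' x) = star (f x)"
  shows "involutive_banach_algebra sc' (f -` S) (\<lambda>x. nrm (f x)) mul' star'"
proof -
  interpret A: involutive_banach_algebra sc S nrm mul star by (rule alg)
  interpret V: vector_space sc' by (rule vs)
  have zero: "f 0 = 0" using add[of 0 0] by simp
  have diff: "f (x - y) = f x - f y" for x y using add[of "x - y" y] by (simp add: algebra_simps)
  have eq: "x = y \<longleftrightarrow> f x = f y" for x y using inv(1) by metis
  note mem = A.subspace_add[OF A.subspace_S] A.subspace_scale[OF A.subspace_S] A.mul_closed A.star_closed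
  show ?thesis
  proof unfold_locales
    show "V.subspace (f -` S)"
      using A.subspace_0[OF A.subspace_S] by (simp add: V.subspace_def zero add scale mem)
  next
    fix X :: "nat \<Rightarrow> _" assume X: "\<And>n. X n \<in> f -` S"
      "\<And>e. 0 < e \<Longrightarrow> \<exists>N. \<forall>m\<ge>N. \<forall>n\<ge>N. nrm (f (X m - X n)) < e"
    have "\<exists>L\<in>S. (\<lambda>n. nrm (f (X n) - L)) \<longlonglongrightarrow> 0"
      by (rule A.complete) (use X in \<open>auto simp: diff\<close>)
    then obtain L where "L \<in> S" "(\<lambda>n. nrm (f (X n) - L)) \<longlonglongrightarrow> 0" by blast
    then show "\<exists>L\<in>f -` S. (\<lambda>n. nrm (f (X n - L))) \<longlonglongrightarrow> 0"
      by (intro bexI[of _ "g L"]) (simp_all add: diff inv(2))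
  qed (simp_all add: eq add scale mul star zero mem A.nrm_nonneg A.nrm_eq_0_iff A.nrm_scale A.nrm_triangle
      A.mul_assoc A.mul_add_left A.mul_add_right A.mul_scale_left A.mul_scale_right A.nrm_mul
      A.star_add A.star_scale A.star_mul A.star_star A.nrm_star)
qed

text \<open>A Cauchy sequence for the maximum has a limit in each algebra. Nothing abstract links
  the two norms, so \<open>limits\<close> is assumed; for tensors it follows from entrywise
  convergence.\<close>

lemma involutive_banach_algebra_Int:
  assumes alg1: "involutive_banach_algebra sc S\<^sub>1 nrm\<^sub>1 mul star"
    and alg2: "involutive_banach_algebra sc S\<^sub>2 nrm\<^sub>2 mul star"
    and nrm: "\<And>x. x \<in> S\<^sub>1 \<inter> S\<^sub>2 \<Longrightarrow> nrm x = max (nrm\<^sub>1 x) (nrm\<^sub>2 x)"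
    and limits: "\<And>X L\<^sub>1 L\<^sub>2. \<lbrakk>\<And>n. X n - L\<^sub>1 \<in> S\<^sub>1; \<And>n. X n - L\<^sub>2 \<in> S\<^sub>2;
      (\<lambda>n::nat. nrm\<^sub>1 (X n - L\<^sub>1)) \<longlonglongrightarrow> 0; (\<lambda>n. nrm\<^sub>2 (X n - L\<^sub>2)) \<longlonglongrightarrow> 0\<rbrakk> \<Longrightarrow> L\<^sub>1 = L\<^sub>2"
  shows "involutive_banach_algebra sc (S\<^sub>1 \<inter> S\<^sub>2) nrm mul star"
proof -
  interpret A: involutive_banach_algebra sc S\<^sub>1 nrm\<^sub>1 mul star by (rule alg1)
  interpret B: involutive_banach_algebra sc S\<^sub>2 nrm\<^sub>2 mul star by (rule alg2)
  have sub: "A.subspace (S\<^sub>1 \<inter> S\<^sub>2)" by (intro A.subspace_inter A.subspace_S B.subspace_S)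
  note mem = A.subspace_add[OF A.subspace_S] A.subspace_scale[OF A.subspace_S] A.mul_closed A.star_closed
    A.subspace_add[OF B.subspace_S] A.subspace_scale[OF B.subspace_S] B.mul_closed B.star_closed
  show ?thesis
  proof unfold_locales
    show "A.subspace (S\<^sub>1 \<inter> S\<^sub>2)" by (rule sub)
  next
    fix x y a assume x: "x \<in> S\<^sub>1 \<inter> S\<^sub>2"
    show "0 \<le> nrm x" using x by (simp add: nrm A.nrm_nonneg le_max_iff_disj)
    show "nrm x = 0 \<longleftrightarrow> x = 0"
      using x A.nrm_nonneg[of x] B.nrm_nonneg[of x] A.nrm_eq_0_iff[of x] B.nrm_eq_0_iff[of x]
      by (auto simp: nrm max_def)
    show "nrm (sc a x) = cmod a * nrm x"
      using x by (simp add: nrm mem A.nrm_scale B.nrm_scale max_mult_distrib_left)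
    assume y: "y \<in> S\<^sub>1 \<inter> S\<^sub>2"
    show "nrm (x + y) \<le> nrm x + nrm y"
      using x y A.nrm_triangle[of x y] B.nrm_triangle[of x y] by (simp add: nrm mem) linarith
    have "nrm\<^sub>1 (mul x y) \<le> nrm\<^sub>1 x * nrm\<^sub>1 y" "nrm\<^sub>2 (mul x y) \<le> nrm\<^sub>2 x * nrm\<^sub>2 y"
      using x y A.nrm_mul B.nrm_mul by auto
    moreover have "nrm\<^sub>1 x * nrm\<^sub>1 y \<le> nrm x * nrm y" "nrm\<^sub>2 x * nrm\<^sub>2 y \<le> nrm x * nrm y"
      using x y A.nrm_nonneg B.nrm_nonneg by (auto simp: nrm le_max_iff_disj intro!: mult_mono)
    ultimately show "nrm (mul x y) \<le> nrm x * nrm y"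
      using x y by (simp add: nrm[of "mul x y"] mem)
  next
    fix X :: "nat \<Rightarrow> _" assume X: "\<And>n. X n \<in> S\<^sub>1 \<inter> S\<^sub>2"
      "\<And>e. 0 < e \<Longrightarrow> \<exists>N. \<forall>m\<ge>N. \<forall>n\<ge>N. nrm (X m - X n) < e"
    have D: "nrm (X m - X n) = max (nrm\<^sub>1 (X m - X n)) (nrm\<^sub>2 (X m - X n))" for m n
      by (intro nrm A.subspace_diff[OF sub] X)
    have "\<exists>L\<in>S\<^sub>1. (\<lambda>n. nrm\<^sub>1 (X n - L)) \<longlonglongrightarrow> 0"
    proof (rule A.complete)
      fix e :: real assume "0 < e"
      from X(2)[OF this] show "\<exists>N. \<forall>m\<ge>N. \<forall>n\<ge>N. nrm\<^sub>1 (X m - X n) < e"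
        unfolding D max_less_iff_conj by blast
    qed (use X(1) in simp)
    then obtain L where L: "L \<in> S\<^sub>1" "(\<lambda>n. nrm\<^sub>1 (X n - L)) \<longlonglongrightarrow> 0" by blast
    have "\<exists>L\<in>S\<^sub>2. (\<lambda>n. nrm\<^sub>2 (X n - L)) \<longlonglongrightarrow> 0"
    proof (rule B.complete)
      fix e :: real assume "0 < e"
      from X(2)[OF this] show "\<exists>N. \<forall>m\<ge>N. \<forall>n\<ge>N. nrm\<^sub>2 (X m - X n) < e"
        unfolding D max_less_iff_conj by blast
    qed (use X(1) in simp)
    then obtain L' where L': "L' \<in> S\<^sub>2" "(\<lambda>n. nrm\<^sub>2 (X n - L')) \<longlonglongrightarrow> 0" by blast
    have "L = L'"
      using X(1) L L' by (intro limits[of X L L'] A.subspace_diff[OF A.subspace_S] A.subspace_diff[OF B.subspace_S]) auto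
    with L L' have LS: "L \<in> S\<^sub>1 \<inter> S\<^sub>2" by simp
    have "(\<lambda>n. max (nrm\<^sub>1 (X n - L)) (nrm\<^sub>2 (X n - L))) \<longlonglongrightarrow> max 0 0"
      using L L' \<open>L = L'\<close> by (intro tendsto_max) auto
    moreover have "nrm (X n - L) = max (nrm\<^sub>1 (X n - L)) (nrm\<^sub>2 (X n - L))" for n
      by (intro nrm A.subspace_diff[OF sub] X LS)
    ultimately have "(\<lambda>n. nrm (X n - L)) \<longlonglongrightarrow> 0" by simp
    with LS show "\<exists>L\<in>S\<^sub>1 \<inter> S\<^sub>2. (\<lambda>n. nrm (X n - L)) \<longlonglongrightarrow> 0" by blast
  qed (simp_all add: nrm mem A.mul_assoc A.mul_add_left A.mul_add_right A.mul_scale_left A.mul_scale_right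
      A.star_add A.star_scale A.star_mul A.star_star A.nrm_star B.nrm_star)
qed

section \<open>Exchange of the two index sets\<close>

definition swap_tens :: "('i, 'k) tensor \<Rightarrow> ('k, 'i) tensor" where
  "swap_tens A = (\<lambda>k i j l. A i k l j)"

lemma swap_tens_swap_tens [simp]: "swap_tens (swap_tens A) = A"
  by (simp add: swap_tens_def)

lemma tilde_norm2_eq: "tilde_norm2 S nrm A = tilde_norm1 S nrm (swap_tens A)"
  by (simp add: tilde_norm1_def tilde_norm2_def swap_tens_def)

lemma tilde2_eq: "tilde2 S nrm = swap_tens -` tilde1 S nrm"
  by (auto simp: tilde1_def tilde2_def tilde_norm2_eq)

text \<open>The exchange permutes the rows (i,k) and the columns (j,l) of the matrix by the same
  flip of pairs.\<close>

lemma bounded_mat_swap_tens: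
  assumes "bounded_mat (tens_mat A)" shows "bounded_mat (tens_mat (swap_tens A))"
proof -
  have "tens_mat (swap_tens A) = (\<lambda>x y. tens_mat A (prod.swap x) (prod.swap y))"
    by (auto simp: fun_eq_iff tens_mat_def swap_tens_def)
  then show ?thesis
    using form_bound_imp_bounded_mat(1)[OF form_bound_reindex[OF bounded_mat_form_bound[OF assms] inj_swap]]
    by simp
qed

lemma bounded_mat_swap_tens_iff: "bounded_mat (tens_mat (swap_tens A)) \<longleftrightarrow> bounded_mat (tens_mat A)"
  using bounded_mat_swap_tens[of A] bounded_mat_swap_tens[of "swap_tens A"] by auto

text \<open>On swapped tensors the outer sum runs over the first index set instead of the second, so
  the identity is the interchange of the two sums.\<close>

lemma swap_tens_mult:
  assumes "bounded_mat (tens_mat A)" "bounded_mat (tens_mat B)"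
  shows "swap_tens (tens_mult A B) = tens_mult (swap_tens A) (swap_tens B)"
proof (intro ext)
  fix k i j l
  have "swap_tens (tens_mult A B) k i j l = tens_mult A B i k l j" by (simp add: swap_tens_def)
  also have "\<dots> = (\<Sum>\<^sub>\<infinity>m. \<Sum>\<^sub>\<infinity>n. A i k n m * B m n l j)" by (rule tens_mult_swap[OF assms])
  also have "\<dots> = tens_mult (swap_tens A) (swap_tens B) k i j l" by (simp add: tens_mult_def swap_tens_def)
  finally show "swap_tens (tens_mult A B) k i j l = tens_mult (swap_tens A) (swap_tens B) k i j l" .
qed

lemma solid_matrix_algebraI:
  assumes "spectral_matrix_algebra S nrm" "solid S nrm"
  shows "solid_matrix_algebra S nrm"
  using assms unfolding spectral_matrix_algebra_def inverse_closed_def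
  by (intro solid_matrix_algebra.intro solid_matrix_algebra_axioms.intro) auto

theorem theorem3p7:
  fixes \<A>\<^sub>1 :: "('i::countable) cmat set" and nrm\<^sub>1 :: "'i cmat \<Rightarrow> real"
    and \<A>\<^sub>2 :: "('k::countable) cmat set" and nrm\<^sub>2 :: "'k cmat \<Rightarrow> real"
  defines "T\<^sub>1 \<equiv> (tilde1 \<A>\<^sub>1 nrm\<^sub>1 :: ('i, 'k) tensor set)"
    and "T\<^sub>2 \<equiv> (tilde2 \<A>\<^sub>2 nrm\<^sub>2 :: ('i, 'k) tensor set)"
  assumes "spectral_matrix_algebra \<A>\<^sub>1 nrm\<^sub>1" and "solid \<A>\<^sub>1 nrm\<^sub>1"
    and "spectral_matrix_algebra \<A>\<^sub>2 nrm\<^sub>2" and "solid \<A>\<^sub>2 nrm\<^sub>2"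
    and "tens_inverse_closed T\<^sub>1" and "tens_inverse_closed T\<^sub>2"
  shows "(\<forall>A \<in> T\<^sub>1 \<inter> T\<^sub>2. \<forall>B \<in> T\<^sub>1 \<inter> T\<^sub>2. \<forall>i k l j.
            (\<lambda>(n, m). A i k n m * B m n l j) summable_on UNIV)
       \<and> involutive_banach_algebra tens_scale (T\<^sub>1 \<inter> T\<^sub>2)
            (\<lambda>A. real_of_ereal (max (tilde_norm1 \<A>\<^sub>1 nrm\<^sub>1 A) (tilde_norm2 \<A>\<^sub>2 nrm\<^sub>2 A)))
            tens_mult tens_adj
       \<and> tens_inverse_closed (T\<^sub>1 \<inter> T\<^sub>2)"
proof -
  interpret A1: solid_matrix_algebra \<A>\<^sub>1 nrm\<^sub>1 using assms by (intro solid_matrix_algebraI)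
  interpret A2: solid_matrix_algebra \<A>\<^sub>2 nrm\<^sub>2 using assms by (intro solid_matrix_algebraI)
  have T2: "T\<^sub>2 = swap_tens -` tilde1 \<A>\<^sub>2 nrm\<^sub>2" by (simp add: T\<^sub>2_def tilde2_eq)
  have bd1: "bounded_mat (tens_mat A)" if "A \<in> T\<^sub>1" for A
    using assms(7) that by (auto simp: tens_inverse_closed_def inverse_closed_def)
  have bd2: "bounded_mat (tens_mat A)" if "A \<in> T\<^sub>2" for A
    using assms(8) that by (auto simp: tens_inverse_closed_def inverse_closed_def)
  have bd2': "bounded_mat (tens_mat A)" if "A \<in> tilde1 \<A>\<^sub>2 nrm\<^sub>2" for A :: "('k, 'i) tensor"
    using bd2[of "swap_tens A"] that by (simp add: T2 bounded_mat_swap_tens_iff)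
  have alg1: "involutive_banach_algebra tens_scale T\<^sub>1 (\<lambda>A. nrm\<^sub>1 (block_norms A)) tens_mult tens_adj"
    unfolding T\<^sub>1_def by (rule A1.involutive_banach_algebra_tilde1) (use bd1 in \<open>simp add: T\<^sub>1_def\<close>)
  have alg2: "involutive_banach_algebra tens_scale T\<^sub>2 (\<lambda>A. nrm\<^sub>2 (block_norms (swap_tens A))) tens_mult tens_adj"
    unfolding T2
  \<comment> \<open>\<open>swap_tens\<close> is its own inverse and hence also serves as
    \<open>g\<close>.\<close>
  proof (rule involutive_banach_algebra_pullback[OF A2.involutive_banach_algebra_tilde1
        vector_space_tens_scale, where g = swap_tens])
    show "swap_tens (tens_mult A B) = tens_mult (swap_tens A) (swap_tens B)"
      if "swap_tens A \<in> tilde1 \<A>\<^sub>2 nrm\<^sub>2" "swap_tens B \<in> tilde1 \<A>\<^sub>2 nrm\<^sub>2" for A B :: "('i, 'k) tensor"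
      using that by (intro swap_tens_mult bd2) (auto simp: T2)
  qed (use bd2' in \<open>auto simp: swap_tens_def tens_scale_def tens_adj_def fun_eq_iff\<close>)
  have "involutive_banach_algebra tens_scale (T\<^sub>1 \<inter> T\<^sub>2)
      (\<lambda>A. real_of_ereal (max (tilde_norm1 \<A>\<^sub>1 nrm\<^sub>1 A) (tilde_norm2 \<A>\<^sub>2 nrm\<^sub>2 A))) tens_mult tens_adj"
  proof (rule involutive_banach_algebra_Int[OF alg1 alg2])
    \<comment> \<open>On the intersection both extended norms are finite, so their maximum is an
      ordinary real one.\<close>
    fix A assume "A \<in> T\<^sub>1 \<inter> T\<^sub>2"
    then show "real_of_ereal (max (tilde_norm1 \<A>\<^sub>1 nrm\<^sub>1 A) (tilde_norm2 \<A>\<^sub>2 nrm\<^sub>2 A))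
        = max (nrm\<^sub>1 (block_norms A)) (nrm\<^sub>2 (block_norms (swap_tens A)))"
      by (simp add: T\<^sub>1_def T2 tilde_norm2_eq tilde_norm1_eq flip: ereal_max)
  next
    fix X :: "nat \<Rightarrow> ('i, 'k) tensor" and L\<^sub>1 L\<^sub>2
    assume X: "\<And>n. X n - L\<^sub>1 \<in> T\<^sub>1" "\<And>n. X n - L\<^sub>2 \<in> T\<^sub>2"
      "(\<lambda>n. nrm\<^sub>1 (block_norms (X n - L\<^sub>1))) \<longlonglongrightarrow> 0"
      "(\<lambda>n. nrm\<^sub>2 (block_norms (swap_tens (X n - L\<^sub>2)))) \<longlonglongrightarrow> 0"
    have diff: "swap_tens (X n - L\<^sub>2) = swap_tens (X n) - swap_tens L\<^sub>2" for n
      by (simp add: swap_tens_def fun_eq_iff)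
    have "L\<^sub>1 i k l j = L\<^sub>2 i k l j" for i k l j
    proof (rule LIMSEQ_unique)
      show "(\<lambda>n. X n i k l j) \<longlonglongrightarrow> L\<^sub>1 i k l j"
        using X by (intro A1.tilde1_tendsto_entry) (auto simp: T\<^sub>1_def)
      have "(\<lambda>n. swap_tens (X n) k i j l) \<longlonglongrightarrow> swap_tens L\<^sub>2 k i j l"
        using X(2,4) by (intro A2.tilde1_tendsto_entry) (simp_all add: T2 diff)
      then show "(\<lambda>n. X n i k l j) \<longlonglongrightarrow> L\<^sub>2 i k l j" by (simp add: swap_tens_def)
    qed
    then show "L\<^sub>1 = L\<^sub>2" by (simp add: fun_eq_iff)
  qed
  \<comment> \<open>The inverse has a single matrix, which lies in both images; injectivity of
    \<open>tens_mat\<close> makes the two representing tensors equal.\<close>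
  moreover have "tens_inverse_closed (T\<^sub>1 \<inter> T\<^sub>2)"
    using assms(7,8) unfolding tens_inverse_closed_def inverse_closed_def image_Int[OF inj_tens_mat] by blast
  ultimately show ?thesis
    using tens_mult_summable_swap[OF bd1 bd1] by simp
qed

end
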